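(* Let $\mathbb{K}=\mathbb{R}$ or $\mathbb{C}$, let $d\geq 1$ be an integer and let $p_1,\dots,p_d\in[2,\infty]$. Put $C_d:=8\,(d!)^{1-\max\left\{\frac12,\frac{1}{\max\{p_1,\dots,p_d\}}\right\}}\sqrt{\log(1+4d)}$. Then for all positive integers $n_1,\dots,n_d$, $$\frac{1}{d\cdot 2^{\frac{d-1}{2}}}\;\leq\;\inf_A \frac{\|A\|}{\left(n_1^{1/2}+\cdots+n_d^{1/2}\right)\prod_{j=1}^{d} n_j^{\frac12-\frac1{p_j}}}\;\leq\; C_d,$$ where the infimum is taken over all unimodular $d$-linear forms $A:\ell_{p_1}^{n_1}\times\cdots\times\ell_{p_d}^{n_d}\to\mathbb{K}$.
   Context: $\ell_p^n$ denotes $\mathbb{K}^n$ with the $\ell_p$-norm, $p\in[1,\infty]$, and $1/\infty:=0$. A $d$-linear form $A:\ell_{p_1}^{n_1}\times\cdots\times\ell_{p_d}^{n_d}\to\mathbb{K}$ is unimodular if $A(x^1,\dots,x^d)=\sum_{j_1=1}^{n_1}\cdots\sum_{j_d=1}^{n_d}\varepsilon_{(j_1,\dots,j_d)}x^1_{j_1}\cdots x^d_{j_d}$ with all coefficients $\varepsilon_{(j_1,\dots,j_d)}\in\{-1,1\}$. The norm is $\|A\|=\sup\{|A(x^1,\dots,x^d)|: \|x^k\|_{\ell_{p_k}^{n_k}}\leq 1,\ k=1,\dots,d\}$. *)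

theory Defs
  imports "HOL-Analysis.Analysis"
begin

text \<open>
  A vector of \<open>\<bbbK>\<^sup>n\<close> is represented by a function \<open>x :: nat \<Rightarrow> 'k\<close> of which only the
  values on \<open>{1..n}\<close> matter, and a \<open>d\<close>-tuple of vectors by \<open>x :: nat \<Rightarrow> nat \<Rightarrow> 'k\<close>, where
  \<open>x k\<close> for \<open>k \<in> {1..d}\<close> is the \<open>k\<close>-th vector. The scalar field \<open>'k\<close> is meant to be
  instantiated to \<open>real\<close> or \<open>complex\<close>.
\<close>

text \<open>In \<open>ereal\<close>, \<open>1 / \<infinity> = 0\<close>.\<close>
abbreviation recip :: "ereal \<Rightarrow> real" where
  "recip p \<equiv> real_of_ereal (1 / p)"

text \<open>Intended for \<open>p \<ge> 1\<close> and \<open>n \<ge> 1\<close>, so that the maximum is over a nonempty set.\<close>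
definition lp_norm :: "ereal \<Rightarrow> nat \<Rightarrow> (nat \<Rightarrow> 'k::real_normed_field) \<Rightarrow> real" where
  "lp_norm p n x =
     (if p = \<infinity> then Max ((\<lambda>j. norm (x j)) ` {1..n})
      else (\<Sum>j=1..n. norm (x j) powr real_of_ereal p) powr recip p)"

definition multi_indices :: "nat \<Rightarrow> (nat \<Rightarrow> nat) \<Rightarrow> (nat \<Rightarrow> nat) set" where
  "multi_indices d n = (\<Pi>\<^sub>E k\<in>{1..d}. {1..n k})"

definition unimodular_forms ::
    "nat \<Rightarrow> (nat \<Rightarrow> nat) \<Rightarrow> ((nat \<Rightarrow> nat \<Rightarrow> 'k::real_normed_field) \<Rightarrow> 'k) set" where
  "unimodular_forms d n =
     {A. \<exists>\<epsilon>. (\<forall>j\<in>multi_indices d n. \<epsilon> j \<in> {-1, 1}) \<and>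
             A = (\<lambda>x. \<Sum>j\<in>multi_indices d n. \<epsilon> j * (\<Prod>k=1..d. x k (j k)))}"

text \<open>For the forms above the supremum is over a nonempty bounded set of reals if all \<open>p k \<ge> 1\<close>.\<close>
definition form_norm ::
    "nat \<Rightarrow> (nat \<Rightarrow> nat) \<Rightarrow> (nat \<Rightarrow> ereal) \<Rightarrow>
     ((nat \<Rightarrow> nat \<Rightarrow> 'k::real_normed_field) \<Rightarrow> 'k) \<Rightarrow> real" where
  "form_norm d n p A = (SUP x\<in>{x. \<forall>k\<in>{1..d}. lp_norm (p k) (n k) (x k) \<le> 1}. norm (A x))"

definition upper_const :: "nat \<Rightarrow> (nat \<Rightarrow> ereal) \<Rightarrow> real" where
  "upper_const d p =
     8 * fact d powr (1 - max (1/2) (recip (Max (p ` {1..d})))) * sqrt (ln (1 + 4 * real d))"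

definition normalized_norm ::
    "nat \<Rightarrow> (nat \<Rightarrow> nat) \<Rightarrow> (nat \<Rightarrow> ereal) \<Rightarrow>
     ((nat \<Rightarrow> nat \<Rightarrow> 'k::real_normed_field) \<Rightarrow> 'k) \<Rightarrow> real" where
  "normalized_norm d n p A =
     form_norm d n p A /
       ((\<Sum>k=1..d. real (n k) powr (1/2)) * (\<Prod>j=1..d. real (n j) powr (1/2 - recip (p j))))"

definition inf_normalized_norm ::
    "'k::real_normed_field itself \<Rightarrow> nat \<Rightarrow> (nat \<Rightarrow> nat) \<Rightarrow> (nat \<Rightarrow> ereal) \<Rightarrow> real" where
  "inf_normalized_norm _ d n p =
     (INF A\<in>(unimodular_forms d n :: ((nat \<Rightarrow> nat \<Rightarrow> 'k) \<Rightarrow> 'k) set). normalized_norm d n p A)"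

end

theory Submission
  imports Defs
begin

text \<open>
  Lower bound. Fill every slot but one with vectors of random signs. The value of the form is then a
  linear form in the vector of the remaining slot \<open>m\<close>, whose coefficients are Rademacher chaoses of
  order \<open>d - 1\<close> with coefficients \<open>\<plusminus>1\<close>. The Khinchin inequality between the first and the second
  moment, with its best constant \<open>1 / \<surd>2\<close> and applied once per random slot
  (\<open>chaos_khinchin\<close>), shows that each of them has mean modulus at least
  \<open>2 powr (-(d - 1) / 2) * (\<Prod>k\<noteq>m. \<surd>n\<^sub>k)\<close>. Choosing the signs in slot \<open>m\<close> optimally adds up these
  \<open>n\<^sub>m\<close> moduli (\<open>exists_signs_large\<close>). Dividing the entries in slot \<open>k\<close> by \<open>n\<^sub>k powr (1 / p\<^sub>k)\<close>
  produces unit vectors, and \<open>m\<close> is taken with \<open>n\<^sub>m\<close> maximal, so that \<open>\<Sum>k. \<surd>n\<^sub>k \<le> d * \<surd>n\<^sub>m\<close>.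
  The Khinchin inequality itself is proved for arbitrary seminorms by the argument of Latala and
  Oleszkiewicz: a Poincare inequality for even functions on the discrete cube, in which evenness
  doubles the spectral gap (\<open>poincare_even\<close>, \<open>second_moment_le\<close>).

  Upper bound. As \<open>\<parallel>x\<parallel>\<^sub>2 \<le> n powr (1/2 - 1/p) * \<parallel>x\<parallel>\<^sub>p\<close> for \<open>p \<ge> 2\<close>, the factor
  \<open>\<Prod>j. n\<^sub>j powr (1/2 - 1/p\<^sub>j)\<close> absorbs the passage to Euclidean balls, and it remains to find signs whose
  form is bounded by \<open>8 * \<surd>(ln (1 + 4 d)) * (\<Sum>k. \<surd>n\<^sub>k)\<close> on complex Euclidean unit balls; the same
  signs then serve the real scalars. At any given point of the balls the real part of a form with random signs
  is subgaussian with variance at most one, so a union bound controls it on a net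
  (\<open>exists_signs_small_on_finite\<close>). The product of nets of mesh \<open>1 / (2 d)\<close> suffices: moving from a point
  to the net changes one slot at a time and costs at most half of the norm (\<open>mform_le_net_bound\<close>). Such
  a net is given by rounding to a grid, and a generating function bounds its cardinality in \<open>\<complex>\<^sup>n\<close> by
  \<open>(e * (1 + 4 d)) ^ (2 n)\<close> (\<open>ball_net\<close>), which is where \<open>ln (1 + 4 d)\<close> comes from.
\<close>

section \<open>Poincare inequalities on the discrete cube\<close>

lemma sum_PiE_insert:
  assumes "k \<notin> K"
  shows "(\<Sum>s\<in>PiE (insert k K) B. g s) = (\<Sum>b\<in>B k. \<Sum>s\<in>PiE K B. g (s(k := b)))"
  unfolding PiE_insert_eq sum.cartesian_product
  by (subst sum.reindex[OF inj_combinator[OF assms]]) (simp add: case_prod_unfold)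

definition cube :: "'i set \<Rightarrow> ('i \<Rightarrow> real) set" where
  "cube I = PiE I (\<lambda>_. {-1, 1})"

definition cube_mean :: "'i set \<Rightarrow> (('i \<Rightarrow> real) \<Rightarrow> real) \<Rightarrow> real" where
  "cube_mean I F = (\<Sum>s\<in>cube I. F s) / 2 ^ card I"

lemma finite_cube: "finite I \<Longrightarrow> finite (cube I)"
  by (simp add: cube_def finite_PiE)

lemma card_cube: "finite I \<Longrightarrow> card (cube I) = 2 ^ card I"
  by (simp add: cube_def card_PiE numeral_2_eq_2)

lemma cube_mean_insert:
  assumes "finite I" "i \<notin> I"
  shows "cube_mean (insert i I) F = cube_mean I (\<lambda>s. (F (s(i := 1)) + F (s(i := -1))) / 2)"
  using assms
  by (simp add: cube_mean_def cube_def sum_PiE_insert sum.distrib sum_divide_distrib[symmetric]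
      add_divide_distrib add.commute)

lemma cube_mean_empty: "cube_mean {} F = F (\<lambda>_. undefined)"
  by (simp add: cube_mean_def cube_def)

lemma cube_mean_add: "cube_mean I (\<lambda>s. F s + G s) = cube_mean I F + cube_mean I G"
  by (simp add: cube_mean_def sum.distrib add_divide_distrib)

lemma cube_mean_diff: "cube_mean I (\<lambda>s. F s - G s) = cube_mean I F - cube_mean I G"
  by (simp add: cube_mean_def sum_subtractf diff_divide_distrib)

lemma cube_mean_cmult: "cube_mean I (\<lambda>s. c * F s) = c * cube_mean I F"
  by (simp add: cube_mean_def sum_distrib_left)

lemma cube_mean_sum: "cube_mean I (\<lambda>s. \<Sum>a\<in>A. F a s) = (\<Sum>a\<in>A. cube_mean I (F a))"
  unfolding cube_mean_def by (subst sum.swap) (simp add: sum_divide_distrib)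

lemma cube_mean_cong: "(\<And>s. s \<in> cube I \<Longrightarrow> F s = G s) \<Longrightarrow> cube_mean I F = cube_mean I G"
  by (simp add: cube_mean_def cong: sum.cong)

lemma cube_mean_mono: "(\<And>s. s \<in> cube I \<Longrightarrow> F s \<le> G s) \<Longrightarrow> cube_mean I F \<le> cube_mean I G"
  by (simp add: cube_mean_def divide_right_mono sum_mono)

lemma cube_mean_nonneg: "(\<And>s. s \<in> cube I \<Longrightarrow> 0 \<le> F s) \<Longrightarrow> 0 \<le> cube_mean I F"
  by (simp add: cube_mean_def sum_nonneg)

lemma cube_memD: "s \<in> cube I \<Longrightarrow> i \<in> I \<Longrightarrow> s i = 1 \<or> s i = -1"
  by (auto simp: cube_def PiE_iff)

lemma cube_flip: "s \<in> cube I \<Longrightarrow> i \<in> I \<Longrightarrow> s(i := - s i) \<in> cube I"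
  by (auto simp: cube_def PiE_iff extensional_def)

lemma cube_mean_flip:
  assumes "i \<in> I"
  shows "cube_mean I (\<lambda>s. F (s(i := - s i))) = cube_mean I F"
proof -
  have "(\<Sum>s\<in>cube I. F (s(i := - s i))) = (\<Sum>s\<in>cube I. F s)"
    by (rule sum.reindex_bij_witness[where i = "\<lambda>s. s(i := - s i)" and j = "\<lambda>s. s(i := - s i)"])
      (auto intro: cube_flip assms)
  then show ?thesis by (simp add: cube_mean_def)
qed

lemma cube_upd: "s \<in> cube I \<Longrightarrow> b \<in> {-1, 1} \<Longrightarrow> s(i := b) \<in> cube (insert i I)"
  by (auto simp: cube_def PiE_iff extensional_def)

lemma cube_neg_upd:
  assumes "i \<notin> I" "s \<in> cube I"
    and parity: "\<And>s. s \<in> cube (insert i I) \<Longrightarrow> F (restrict (\<lambda>j. - s j) (insert i I)) = c * F s"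
  shows "F ((restrict (\<lambda>j. - s j) I)(i := 1)) = c * F (s(i := -1))"
    and "F ((restrict (\<lambda>j. - s j) I)(i := -1)) = c * F (s(i := 1))"
proof -
  have eq: "(restrict (\<lambda>j. - s j) I)(i := b) = restrict (\<lambda>j. - (s(i := - b)) j) (insert i I)" for b
    using assms(1,2) by (auto simp: fun_eq_iff)
  show "F ((restrict (\<lambda>j. - s j) I)(i := 1)) = c * F (s(i := -1))"
    unfolding eq using parity[OF cube_upd[OF assms(2), of "-1"]] by simp
  show "F ((restrict (\<lambda>j. - s j) I)(i := -1)) = c * F (s(i := 1))"
    unfolding eq using parity[OF cube_upd[OF assms(2), of 1]] by simp
qed

text \<open>
  Averaging over one coordinate preserves oddness, which reduces the claim to the cube over the empty
  set. That cube has a single point, which negation fixes.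
\<close>

lemma cube_mean_odd:
  assumes "finite I" "\<And>s. s \<in> cube I \<Longrightarrow> F (restrict (\<lambda>j. - s j) I) = - F s"
  shows "cube_mean I F = 0"
  using assms
proof (induction I arbitrary: F rule: finite_induct)
  case empty
  have "F (\<lambda>_. undefined) = - F (\<lambda>_. undefined)"
    using empty[of "\<lambda>_. undefined"] by (simp add: cube_def restrict_def)
  then show ?case by (simp add: cube_mean_empty)
next
  case (insert i I)
  show ?case
    unfolding cube_mean_insert[OF insert.hyps]
  proof (rule insert.IH)
    fix s assume "s \<in> cube I"
    note neg = cube_neg_upd[OF insert.hyps(2) this, where F = F and c = "- 1"]
    show "(F ((restrict (\<lambda>j. - s j) I)(i := 1)) + F ((restrict (\<lambda>j. - s j) I)(i := -1))) / 2
        = - ((F (s(i := 1)) + F (s(i := -1))) / 2)"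
      using neg insert.prems by (simp add: field_simps)
  qed
qed

text \<open>
  In terms of the Walsh expansion of \<open>F\<close> this is \<open>\<Sum>S. |S| * (F\<^sub>S)\<^sup>2\<close>, where \<open>F\<^sub>S\<close> is the coefficient at the
  character \<open>\<Prod>i\<in>S. s i\<close>.
\<close>

definition dirichlet :: "'i set \<Rightarrow> (('i \<Rightarrow> real) \<Rightarrow> real) \<Rightarrow> real" where
  "dirichlet I F = cube_mean I (\<lambda>s. \<Sum>i\<in>I. ((F s - F (s(i := - s i))) / 2)\<^sup>2)"

text \<open>
  The decomposition \<open>F = u + s i * v\<close> separates the characters that avoid the new coordinate from
  those that contain it; the latter have one more factor, whence the last summand.
\<close>

lemma dirichlet_insert:
  fixes F :: "('i \<Rightarrow> real) \<Rightarrow> real"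
  assumes "finite I" "i \<notin> I"
  defines "u \<equiv> \<lambda>s. (F (s(i := 1)) + F (s(i := -1))) / 2"
    and "v \<equiv> \<lambda>s. (F (s(i := 1)) - F (s(i := -1))) / 2"
  shows "dirichlet (insert i I) F = dirichlet I u + dirichlet I v + cube_mean I (\<lambda>s. (v s)\<^sup>2)"
proof -
  let ?D = "\<lambda>F (s :: 'i \<Rightarrow> real) l. ((F s - F (s(l := - s l))) / 2)\<^sup>2"
  have swap: "?D F (s(i := b)) l = ((F (s(i := b)) - F ((s(l := - s l))(i := b))) / 2)\<^sup>2"
    if "l \<in> I" for s b l
    using that assms(2) by (auto simp: fun_upd_twist)
  have point: "((\<Sum>l\<in>insert i I. ?D F (s(i := 1)) l) + (\<Sum>l\<in>insert i I. ?D F (s(i := -1)) l)) / 2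
      = (\<Sum>l\<in>I. ?D u s l) + (\<Sum>l\<in>I. ?D v s l) + (v s)\<^sup>2" for s
  proof -
    have "(?D F (s(i := 1)) l + ?D F (s(i := -1)) l) / 2 = ?D u s l + ?D v s l" if "l \<in> I" for l
      unfolding swap[OF that] u_def v_def by (simp add: power2_eq_square field_simps)
    then have "(\<Sum>l\<in>I. (?D F (s(i := 1)) l + ?D F (s(i := -1)) l) / 2)
        = (\<Sum>l\<in>I. ?D u s l + ?D v s l)"
      by (intro sum.cong) auto
    moreover have "(?D F (s(i := 1)) i + ?D F (s(i := -1)) i) / 2 = (v s)\<^sup>2"
      unfolding v_def by (simp add: power2_eq_square field_simps)
    ultimately show ?thesis
      unfolding sum.insert[OF assms(1,2)] sum_divide_distrib[symmetric] sum.distrib by argo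
  qed
  show ?thesis
    unfolding dirichlet_def cube_mean_insert[OF assms(1,2)] point cube_mean_add ..
qed

lemma cube_mean_square_insert:
  fixes F :: "('i \<Rightarrow> real) \<Rightarrow> real"
  assumes "finite I" "i \<notin> I"
  defines "u \<equiv> \<lambda>s. (F (s(i := 1)) + F (s(i := -1))) / 2"
    and "v \<equiv> \<lambda>s. (F (s(i := 1)) - F (s(i := -1))) / 2"
  shows "cube_mean (insert i I) (\<lambda>s. (F s)\<^sup>2) = cube_mean I (\<lambda>s. (u s)\<^sup>2) + cube_mean I (\<lambda>s. (v s)\<^sup>2)"
  unfolding cube_mean_insert[OF assms(1,2)] cube_mean_add[symmetric] u_def v_def
  by (intro cube_mean_cong) (simp add: power2_eq_square field_simps)

text \<open>
  All nonconstant characters have degree at least one.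
\<close>

lemma poincare:
  assumes "finite I"
  shows "cube_mean I (\<lambda>s. (F s)\<^sup>2) - (cube_mean I F)\<^sup>2 \<le> dirichlet I F"
  using assms
proof (induction I arbitrary: F rule: finite_induct)
  case empty
  then show ?case by (simp add: cube_mean_empty dirichlet_def)
next
  case (insert i I)
  let ?u = "\<lambda>s. (F (s(i := 1)) + F (s(i := -1))) / 2"
  let ?v = "\<lambda>s. (F (s(i := 1)) - F (s(i := -1))) / 2"
  have "0 \<le> dirichlet I ?v"
    unfolding dirichlet_def by (intro cube_mean_nonneg sum_nonneg) simp
  then show ?case
    using insert.IH[of ?u]
    unfolding dirichlet_insert[OF insert.hyps] cube_mean_square_insert[OF insert.hyps]
      cube_mean_insert[OF insert.hyps, of F] by simp
qed

text \<open>
  An even function has no characters of degree one, so its nonconstant characters have degree at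
  least two. In the induction this appears as follows: the part \<open>v\<close> that multiplies the new coordinate
  is odd, hence has mean zero, and its variance is the full second moment.
\<close>

lemma poincare_even:
  assumes "finite I" "\<And>s. s \<in> cube I \<Longrightarrow> F (restrict (\<lambda>j. - s j) I) = F s"
  shows "2 * (cube_mean I (\<lambda>s. (F s)\<^sup>2) - (cube_mean I F)\<^sup>2) \<le> dirichlet I F"
  using assms
proof (induction I arbitrary: F rule: finite_induct)
  case empty
  then show ?case by (simp add: cube_mean_empty dirichlet_def)
next
  case (insert i I)
  let ?u = "\<lambda>s. (F (s(i := 1)) + F (s(i := -1))) / 2"
  let ?v = "\<lambda>s. (F (s(i := 1)) - F (s(i := -1))) / 2"
  have neg: "F ((restrict (\<lambda>j. - s j) I)(i := 1)) = F (s(i := -1))"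
    "F ((restrict (\<lambda>j. - s j) I)(i := -1)) = F (s(i := 1))" if "s \<in> cube I" for s
    using cube_neg_upd[OF insert.hyps(2) that, where F = F and c = 1] insert.prems by simp_all
  have "cube_mean I ?v = 0"
    by (rule cube_mean_odd[OF insert.hyps(1)]) (simp only: neg, simp add: field_simps)
  then have "cube_mean I (\<lambda>s. (?v s)\<^sup>2) \<le> dirichlet I ?v"
    using poincare[OF insert.hyps(1), of ?v] by simp
  moreover have "2 * (cube_mean I (\<lambda>s. (?u s)\<^sup>2) - (cube_mean I ?u)\<^sup>2) \<le> dirichlet I ?u"
    by (rule insert.IH) (simp only: neg add.commute)
  ultimately show ?case
    unfolding dirichlet_insert[OF insert.hyps] cube_mean_square_insert[OF insert.hyps]
      cube_mean_insert[OF insert.hyps, of F] by argo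
qed

section \<open>The Khinchin inequality with the sharp constant\<close>

text \<open>
  The hypothesis \<open>flips\<close> says that \<open>L F \<le> F\<close> for the generator \<open>L F s = (\<Sum>i. F s - F (s with i flipped)) / 2\<close>
  of the Dirichlet form. Hence the Dirichlet form is at most the second moment, and the Poincare
  inequality for even functions turns this into a bound of the variance.
\<close>

lemma second_moment_le:
  assumes fin: "finite I"
    and nonneg: "\<And>s. s \<in> cube I \<Longrightarrow> 0 \<le> F s"
    and even: "\<And>s. s \<in> cube I \<Longrightarrow> F (restrict (\<lambda>j. - s j) I) = F s"
    and flips: "\<And>s. s \<in> cube I \<Longrightarrow> (real (card I) - 2) * F s \<le> (\<Sum>i\<in>I. F (s(i := - s i)))"
  shows "cube_mean I (\<lambda>s. (F s)\<^sup>2) \<le> 2 * (cube_mean I F)\<^sup>2"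
proof -
  let ?M = "cube_mean I (\<lambda>s. (F s)\<^sup>2)"
  have "dirichlet I F = (\<Sum>i\<in>I. cube_mean I (\<lambda>s. ((F s - F (s(i := - s i))) / 2)\<^sup>2))"
    unfolding dirichlet_def by (rule cube_mean_sum)
  also have "\<dots> = (\<Sum>i\<in>I. 1/2 * ?M - 1/2 * cube_mean I (\<lambda>s. F s * F (s(i := - s i))))"
  proof (rule sum.cong[OF refl])
    fix i assume "i \<in> I"
    have "cube_mean I (\<lambda>s. ((F s - F (s(i := - s i))) / 2)\<^sup>2)
      = cube_mean I (\<lambda>s. 1/4 * (F s)\<^sup>2 + 1/4 * (F (s(i := - s i)))\<^sup>2 - 1/2 * (F s * F (s(i := - s i))))"
      by (intro cube_mean_cong) (simp add: power2_eq_square field_simps)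
    also have "\<dots> = 1/4 * ?M + 1/4 * ?M - 1/2 * cube_mean I (\<lambda>s. F s * F (s(i := - s i)))"
      unfolding cube_mean_diff cube_mean_add cube_mean_cmult
      using cube_mean_flip[OF \<open>i \<in> I\<close>, of "\<lambda>s. (F s)\<^sup>2"] by simp
    finally show "cube_mean I (\<lambda>s. ((F s - F (s(i := - s i))) / 2)\<^sup>2)
      = 1/2 * ?M - 1/2 * cube_mean I (\<lambda>s. F s * F (s(i := - s i)))" by simp
  qed
  also have "\<dots> = card I / 2 * ?M - 1/2 * cube_mean I (\<lambda>s. F s * (\<Sum>i\<in>I. F (s(i := - s i))))"
    by (simp add: sum_subtractf cube_mean_sum sum_distrib_left)
  also have "\<dots> \<le> card I / 2 * ?M - 1/2 * cube_mean I (\<lambda>s. (real (card I) - 2) * (F s)\<^sup>2)"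
  proof -
    have "cube_mean I (\<lambda>s. (real (card I) - 2) * (F s)\<^sup>2)
        \<le> cube_mean I (\<lambda>s. F s * (\<Sum>i\<in>I. F (s(i := - s i))))"
    proof (rule cube_mean_mono)
      fix s assume "s \<in> cube I"
      then show "(real (card I) - 2) * (F s)\<^sup>2 \<le> F s * (\<Sum>i\<in>I. F (s(i := - s i)))"
        using mult_left_mono[OF flips nonneg, of s s] by (simp add: power2_eq_square algebra_simps)
    qed
    then show ?thesis by simp
  qed
  also have "\<dots> = ?M"
    unfolding cube_mean_cmult by (simp add: field_simps)
  finally show ?thesis
    using poincare_even[where F = F, OF fin even] by simp
qed

text \<open>
  Flipping each sign of \<open>\<Sum>i. s i * v i\<close> in turn and adding up the results multiplies the vector by
  \<open>card I - 2\<close>, so the triangle inequality yields the hypothesis \<open>flips\<close> above.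
\<close>

lemma khinchin_seminorm:
  fixes q :: "('c \<Rightarrow> real) \<Rightarrow> real" and v :: "'i \<Rightarrow> 'c \<Rightarrow> real"
  assumes fin: "finite I"
    and add: "\<And>x y. q (\<lambda>c. x c + y c) \<le> q x + q y"
    and scale: "\<And>a x. q (\<lambda>c. a * x c) = \<bar>a\<bar> * q x"
    and nonneg: "\<And>x. 0 \<le> q x"
  defines "F \<equiv> \<lambda>s. q (\<lambda>c. \<Sum>i\<in>I. s i * v i c)"
  shows "cube_mean I (\<lambda>s. (F s)\<^sup>2) \<le> 2 * (cube_mean I F)\<^sup>2"
proof (rule second_moment_le[OF fin])
  have sub: "q (\<lambda>c. \<Sum>a\<in>A. x a c) \<le> (\<Sum>a\<in>A. q (x a))" if "finite A" for A :: "'i set" and x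
    using that
  proof induction
    case empty
    then show ?case using scale[of 0] by simp
  next
    case (insert a A)
    then show ?case using add[of "x a" "\<lambda>c. \<Sum>a\<in>A. x a c"] by simp
  qed
  fix s :: "'i \<Rightarrow> real"
  show "0 \<le> F s" by (simp add: F_def nonneg)
  have "F (restrict (\<lambda>j. - s j) I) = q (\<lambda>c. (- 1) * (\<Sum>i\<in>I. s i * v i c))"
    unfolding F_def by (simp add: sum_negf cong: sum.cong)
  also have "\<dots> = F s" unfolding scale F_def by simp
  finally show "F (restrict (\<lambda>j. - s j) I) = F s" .
  have "(\<Sum>i\<in>I. \<Sum>l\<in>I. (s(i := - s i)) l * v l c) = (real (card I) - 2) * (\<Sum>l\<in>I. s l * v l c)" for c
  proof -
    have "(\<Sum>l\<in>I. (s(i := - s i)) l * v l c) = (\<Sum>l\<in>I. s l * v l c) - 2 * (s i * v i c)"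
      if "i \<in> I" for i
      using fin that by (simp add: sum.remove[OF fin that] cong: sum.cong_simp)
    then have "(\<Sum>i\<in>I. \<Sum>l\<in>I. (s(i := - s i)) l * v l c)
        = (\<Sum>i\<in>I. (\<Sum>l\<in>I. s l * v l c) - 2 * (s i * v i c))"
      by (rule sum.cong[OF refl])
    then show ?thesis
      by (simp only: sum_subtractf sum_distrib_left[symmetric]) (simp add: algebra_simps)
  qed
  then have "\<bar>real (card I) - 2\<bar> * F s = q (\<lambda>c. \<Sum>i\<in>I. \<Sum>l\<in>I. (s(i := - s i)) l * v l c)"
    unfolding F_def by (simp only: scale)
  also have "\<dots> \<le> (\<Sum>i\<in>I. F (s(i := - s i)))"
    unfolding F_def by (rule sub[OF fin])
  finally show "(real (card I) - 2) * F s \<le> (\<Sum>i\<in>I. F (s(i := - s i)))"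
    using mult_right_mono[OF abs_ge_self[of "real (card I) - 2"] \<open>0 \<le> F s\<close>] by linarith
qed

lemma cube_mean_square_sum:
  assumes "finite I"
  shows "cube_mean I (\<lambda>s. (\<Sum>i\<in>I. s i * c i)\<^sup>2) = (\<Sum>i\<in>I. (c i)\<^sup>2)"
  using assms
proof (induction I rule: finite_induct)
  case empty
  then show ?case by (simp add: cube_mean_empty)
next
  case (insert i I)
  have inner: "(\<Sum>l\<in>I. (s(i := b)) l * c l) = (\<Sum>l\<in>I. s l * c l)" for s b
    using insert.hyps by (intro sum.cong) auto
  have "cube_mean (insert i I) (\<lambda>s. (\<Sum>i\<in>insert i I. s i * c i)\<^sup>2)
    = cube_mean I (\<lambda>s. (\<Sum>i\<in>I. s i * c i)\<^sup>2 + (c i)\<^sup>2)"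
    unfolding cube_mean_insert[OF insert.hyps]
    by (intro cube_mean_cong, unfold sum.insert[OF insert.hyps] inner)
       (simp add: power2_eq_square field_simps)
  also have "\<dots> = (\<Sum>i\<in>I. (c i)\<^sup>2) + (c i)\<^sup>2"
    using insert.hyps by (simp add: cube_mean_add insert.IH) (simp add: cube_mean_def card_cube)
  finally show ?case using insert.hyps by simp
qed

section \<open>Multilinear forms with random signs\<close>

text \<open>
  The slots form an arbitrary set \<open>K\<close>, since proofs by induction fill them one after the other.
\<close>

definition mform ::
    "nat set \<Rightarrow> (nat \<Rightarrow> nat) \<Rightarrow> ((nat \<Rightarrow> nat) \<Rightarrow> 'k) \<Rightarrow> (nat \<Rightarrow> nat \<Rightarrow> 'k) \<Rightarrow> 'k::real_normed_field"
  where "mform K n a x = (\<Sum>j\<in>PiE K (\<lambda>k. {1..n k}). a j * (\<Prod>k\<in>K. x k (j k)))"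

lemma mform_insert:
  assumes "finite K" "k \<notin> K"
  shows "mform (insert k K) n a (s(k := b)) = mform K n (\<lambda>j. \<Sum>i\<in>{1..n k}. b i * a (j(k := i))) s"
proof -
  have "(\<Prod>l\<in>K. (s(k := b)) l ((j(k := i)) l)) = (\<Prod>l\<in>K. s l (j l))" for j i
    using assms by (intro prod.cong) auto
  then show ?thesis
    unfolding mform_def sum_PiE_insert[OF assms(2)]
    using assms
    by (subst sum.swap) (simp add: sum_distrib_left sum_distrib_right mult_ac fun_upd_same del: fun_upd_apply)
qed

lemma mform_sum:
  "mform K n (\<lambda>j. \<Sum>i\<in>I. c i * a i j) x = (\<Sum>i\<in>I. c i * mform K n (a i) x)"
  unfolding mform_def by (simp only: sum_distrib_right sum_distrib_left, subst sum.swap) (simp add: mult_ac)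

lemma mform_add: "mform K n (\<lambda>j. a j + b j) x = mform K n a x + mform K n b x"
  by (simp add: mform_def algebra_simps sum.distrib)

lemma mform_cmult: "mform K n (\<lambda>j. c * a j) x = c * mform K n a x"
  by (simp add: mform_def sum_distrib_left mult_ac)

definition rad_mean :: "nat set \<Rightarrow> (nat \<Rightarrow> nat) \<Rightarrow> ((nat \<Rightarrow> nat \<Rightarrow> real) \<Rightarrow> real) \<Rightarrow> real" where
  "rad_mean K n G = (\<Sum>s\<in>PiE K (\<lambda>k. cube {1..n k}). G s) / 2 ^ (\<Sum>k\<in>K. n k)"

lemma rad_mean_insert:
  assumes "finite K" "k \<notin> K"
  shows "rad_mean (insert k K) n G = cube_mean {1..n k} (\<lambda>b. rad_mean K n (\<lambda>s. G (s(k := b))))"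
  using assms
  by (simp add: rad_mean_def cube_mean_def sum_PiE_insert power_add sum_divide_distrib[symmetric]
      mult.commute)

lemma rad_mean_add: "rad_mean K n (\<lambda>s. F s + G s) = rad_mean K n F + rad_mean K n G"
  by (simp add: rad_mean_def sum.distrib add_divide_distrib)

lemma rad_mean_cmult: "rad_mean K n (\<lambda>s. c * F s) = c * rad_mean K n F"
  by (simp add: rad_mean_def sum_distrib_left)

lemma rad_mean_sum: "rad_mean K n (\<lambda>s. \<Sum>a\<in>A. F a s) = (\<Sum>a\<in>A. rad_mean K n (F a))"
  unfolding rad_mean_def by (subst sum.swap) (simp add: sum_divide_distrib)

lemma rad_mean_mono: "(\<And>s. F s \<le> G s) \<Longrightarrow> rad_mean K n F \<le> rad_mean K n G"
  by (simp add: rad_mean_def divide_right_mono sum_mono)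

lemma rad_mean_le_exists:
  assumes "finite K"
  shows "\<exists>s\<in>PiE K (\<lambda>k. cube {1..n k}). rad_mean K n F \<le> F s"
proof (rule ccontr)
  let ?P = "PiE K (\<lambda>k. cube {1..n k})"
  assume "\<not> ?thesis"
  then have less: "F s < rad_mean K n F" if "s \<in> ?P" for s using that by force
  have fin: "finite ?P" by (simp add: assms finite_PiE finite_cube)
  have card: "card ?P = 2 ^ (\<Sum>k\<in>K. n k)"
    by (simp add: assms card_PiE card_cube power_sum)
  then have "?P \<noteq> {}" by force
  then have "(\<Sum>s\<in>?P. F s) < (\<Sum>s\<in>?P. rad_mean K n F)"
    by (intro sum_strict_mono) (use fin less in auto)
  also have "\<dots> = (\<Sum>s\<in>?P. F s)" using card by (simp add: rad_mean_def)
  finally show False by simp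
qed

text \<open>
  With the vector \<open>b\<close> of one slot fixed, the mean modulus over the other slots is a seminorm of the
  coefficients of the remaining form, and these depend linearly on \<open>b\<close>. Thus \<open>khinchin_seminorm\<close>
  applies to this slot at the cost of a factor two, and the other slots are handled by induction.
\<close>

lemma chaos_khinchin:
  fixes a :: "(nat \<Rightarrow> nat) \<Rightarrow> real"
  assumes "finite K"
  shows "(\<Sum>j\<in>PiE K (\<lambda>k. {1..n k}). (a j)\<^sup>2)
    \<le> 2 ^ card K * (rad_mean K n (\<lambda>s. \<bar>mform K n a s\<bar>))\<^sup>2"
  using assms
proof (induction K arbitrary: a rule: finite_induct)
  case empty
  then show ?case by (simp add: rad_mean_def mform_def)
next
  case (insert k K)
  define q where "q = (\<lambda>a. rad_mean K n (\<lambda>s. \<bar>mform K n a s\<bar>))"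
  define F where "F = (\<lambda>b. q (\<lambda>j. \<Sum>i\<in>{1..n k}. b i * a (j(k := i))))"
  \<comment> \<open>The seminorm q is the mean modulus over the slots in K.\<close>
  have mean: "rad_mean (insert k K) n (\<lambda>s. \<bar>mform (insert k K) n a s\<bar>) = cube_mean {1..n k} F"
    unfolding rad_mean_insert[OF insert.hyps] mform_insert[OF insert.hyps] F_def q_def ..
  have "(\<Sum>j\<in>PiE (insert k K) (\<lambda>k. {1..n k}). (a j)\<^sup>2)
      = (\<Sum>j\<in>PiE K (\<lambda>k. {1..n k}). \<Sum>i\<in>{1..n k}. (a (j(k := i)))\<^sup>2)"
    unfolding sum_PiE_insert[OF insert.hyps(2)] by (rule sum.swap)
  also have "\<dots> = cube_mean {1..n k}
      (\<lambda>b. \<Sum>j\<in>PiE K (\<lambda>k. {1..n k}). (\<Sum>i\<in>{1..n k}. b i * a (j(k := i)))\<^sup>2)"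
    by (simp add: cube_mean_sum cube_mean_square_sum)
  also have "\<dots> \<le> cube_mean {1..n k} (\<lambda>b. 2 ^ card K * (F b)\<^sup>2)"
    by (rule cube_mean_mono) (simp only: F_def q_def insert.IH)
  also have "\<dots> = 2 ^ card K * cube_mean {1..n k} (\<lambda>b. (F b)\<^sup>2)"
    by (rule cube_mean_cmult)
  also have "\<dots> \<le> 2 ^ card K * (2 * (cube_mean {1..n k} F)\<^sup>2)"
  proof (rule mult_left_mono)
    show "cube_mean {1..n k} (\<lambda>b. (F b)\<^sup>2) \<le> 2 * (cube_mean {1..n k} F)\<^sup>2"
      unfolding F_def
    proof (rule khinchin_seminorm[where v = "\<lambda>i j. a (j(k := i))"])
      fix x y :: "(nat \<Rightarrow> nat) \<Rightarrow> real" and c :: real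
      show "q (\<lambda>j. x j + y j) \<le> q x + q y"
        unfolding q_def mform_add rad_mean_add[symmetric] by (rule rad_mean_mono) simp
      show "q (\<lambda>j. c * x j) = \<bar>c\<bar> * q x"
        unfolding q_def mform_cmult rad_mean_cmult[symmetric] abs_mult ..
      show "0 \<le> q x"
        unfolding q_def rad_mean_def by (intro divide_nonneg_nonneg sum_nonneg) auto
    qed simp
  qed simp
  finally show ?case
    unfolding mean using insert.hyps by simp
qed

text \<open>
  Only the slots in \<open>K\<close> are random. The signs in slot \<open>k\<close> are chosen afterwards, to match those of the
  \<open>n k\<close> coefficients, so that this slot contributes the factor \<open>n k\<close> rather than its square root.
\<close>

lemma exists_signs_large:
  fixes e :: "(nat \<Rightarrow> nat) \<Rightarrow> real"
  assumes "finite K" "k \<notin> K"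
    and e: "\<And>j. j \<in> PiE (insert k K) (\<lambda>k. {1..n k}) \<Longrightarrow> \<bar>e j\<bar> = 1"
  obtains x where "\<And>l i. l \<in> insert k K \<Longrightarrow> i \<in> {1..n l} \<Longrightarrow> \<bar>x l i\<bar> = (1::real)"
    and "n k * (\<Prod>l\<in>K. sqrt (n l)) / sqrt 2 ^ card K \<le> mform (insert k K) n e x"
proof -
  define c where "c = (\<Prod>l\<in>K. sqrt (n l)) / sqrt 2 ^ card K"
  define e' where "e' = (\<lambda>i j. e (j(k := i)))"
  have "c \<le> rad_mean K n (\<lambda>s. \<bar>mform K n (e' i) s\<bar>)" if "i \<in> {1..n k}" for i
  proof (rule power2_le_imp_le)
    have "(\<Sum>j\<in>PiE K (\<lambda>k. {1..n k}). (e' i j)\<^sup>2) = (\<Sum>j\<in>PiE K (\<lambda>k. {1..n k}). 1)"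
    proof (rule sum.cong[OF refl])
      fix j assume "j \<in> PiE K (\<lambda>k. {1..n k})"
      then have "j(k := i) \<in> PiE (insert k K) (\<lambda>k. {1..n k})"
        using that by (intro PiE_fun_upd) auto
      then show "(e' i j)\<^sup>2 = 1"
        using e by (metis e'_def one_power2 power2_abs)
    qed
    also have "\<dots> = (\<Prod>l\<in>K. real (n l))"
      by (simp add: card_PiE assms(1))
    also have "\<dots> = 2 ^ card K * c\<^sup>2"
      by (simp add: c_def power_divide prod_power_distrib power_mult[symmetric]
          mult.commute[of _ 2] power_mult)
    finally have "2 ^ card K * c\<^sup>2 \<le> 2 ^ card K * (rad_mean K n (\<lambda>s. \<bar>mform K n (e' i) s\<bar>))\<^sup>2"
      using chaos_khinchin[OF assms(1), of "e' i" n] by simp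
    then show "c\<^sup>2 \<le> (rad_mean K n (\<lambda>s. \<bar>mform K n (e' i) s\<bar>))\<^sup>2" by simp
    show "0 \<le> rad_mean K n (\<lambda>s. \<bar>mform K n (e' i) s\<bar>)"
      unfolding rad_mean_def by (intro divide_nonneg_nonneg sum_nonneg) auto
  qed
  then have "(\<Sum>i\<in>{1..n k}. c) \<le> rad_mean K n (\<lambda>s. \<Sum>i\<in>{1..n k}. \<bar>mform K n (e' i) s\<bar>)"
    unfolding rad_mean_sum by (rule sum_mono)
  moreover obtain s where s: "s \<in> PiE K (\<lambda>k. cube {1..n k})"
    and "rad_mean K n (\<lambda>s. \<Sum>i\<in>{1..n k}. \<bar>mform K n (e' i) s\<bar>) \<le> (\<Sum>i\<in>{1..n k}. \<bar>mform K n (e' i) s\<bar>)"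
    using rad_mean_le_exists[OF assms(1)] by fast
  ultimately have large: "n k * c \<le> (\<Sum>i\<in>{1..n k}. \<bar>mform K n (e' i) s\<bar>)" by simp
  define b where "b = (\<lambda>i. if 0 \<le> mform K n (e' i) s then 1 else - 1 :: real)"
  have "mform (insert k K) n e (s(k := b)) = (\<Sum>i\<in>{1..n k}. b i * mform K n (e' i) s)"
    unfolding mform_insert[OF assms(1,2)] mform_sum[symmetric] e'_def ..
  also have "\<dots> = (\<Sum>i\<in>{1..n k}. \<bar>mform K n (e' i) s\<bar>)"
    by (intro sum.cong) (auto simp: b_def)
  finally have "n k * c \<le> mform (insert k K) n e (s(k := b))" using large by simp
  moreover have "\<bar>(s(k := b)) l i\<bar> = 1" if "l \<in> insert k K" "i \<in> {1..n l}" for l i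
    using that s cube_memD[of "s l" "{1..n l}" i] by (auto simp: b_def PiE_iff)
  ultimately show thesis
    using that[of "s(k := b)"] by (simp add: c_def)
qed

section \<open>The lower bound\<close>

lemma two_le_ereal_cases:
  assumes "2 \<le> (p::ereal)"
  obtains "p = \<infinity>" "recip p = 0"
  | r where "p = ereal r" "2 \<le> r" "recip p = 1 / r"
proof (cases p)
  case (real r)
  then show ?thesis using that(2)[of r] assms by (simp add: one_ereal_def)
next
  case PInf
  then show ?thesis using that(1) by simp
next
  case MInf
  then show ?thesis using assms by simp
qed

lemma sum_powr_le_one:
  assumes "2 \<le> r" "lp_norm (ereal r) n x \<le> 1"
  shows "(\<Sum>j=1..n. norm (x j) powr r) \<le> 1"
proof -
  have "(\<Sum>j=1..n. norm (x j) powr r) powr (1 / r) \<le> 1"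
    using assms by (simp add: lp_norm_def one_ereal_def)
  moreover have "0 < 1 / r" using assms(1) by simp
  ultimately show ?thesis
    using gr_one_powr[of "\<Sum>j=1..n. norm (x j) powr r" "1 / r"] by linarith
qed

lemma norm_le_lp_norm:
  assumes "2 \<le> p" "lp_norm p n x \<le> 1" "i \<in> {1..n}"
  shows "norm (x i) \<le> 1"
  using assms(1)
proof (cases rule: two_le_ereal_cases)
  case 1
  then have "norm (x i) \<le> lp_norm p n x"
    using assms(3) by (auto simp: lp_norm_def intro!: Max_ge)
  then show ?thesis using assms(2) by simp
next
  case (2 r)
  have sum: "(\<Sum>j=1..n. norm (x j) powr r) \<le> 1"
    using sum_powr_le_one 2 assms(2) by blast
  have "norm (x i) powr r \<le> (\<Sum>j=1..n. norm (x j) powr r)"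
    using assms(3) by (intro member_le_sum) auto
  then show ?thesis
    using sum 2(2) gr_one_powr[of "norm (x i)" r] by linarith
qed

lemma lp_norm_constant_modulus:
  assumes "2 \<le> p" "1 \<le> n" "\<And>i. i \<in> {1..n} \<Longrightarrow> norm (x i) = real n powr (- recip p)"
  shows "lp_norm p n x = 1"
  using assms(1)
proof (cases rule: two_le_ereal_cases)
  case 1
  then have "(\<lambda>j. norm (x j)) ` {1..n} = {1}"
    using assms by force
  then show ?thesis using 1 by (simp add: lp_norm_def)
next
  case (2 r)
  then have "(\<Sum>j=1..n. norm (x j) powr r) = (\<Sum>j=1..n. 1 / n)"
    using assms(2,3) by (intro sum.cong) (auto simp: powr_powr powr_minus[of _ 1])
  then show ?thesis using 2 assms(2) by (simp add: lp_norm_def)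
qed

text \<open>
  A crude bound; it serves to show that the suprema that define norms of forms are taken over bounded sets.
\<close>

lemma mform_norm_le:
  assumes a: "\<And>j. j \<in> PiE K (\<lambda>k. {1..n k}) \<Longrightarrow> norm (a j) = 1"
    and x: "\<And>k i. k \<in> K \<Longrightarrow> i \<in> {1..n k} \<Longrightarrow> norm (x k i) \<le> 1"
  shows "norm (mform K n a x) \<le> real (card (PiE K (\<lambda>k. {1..n k})))"
proof -
  have "norm (mform K n a x) \<le> (\<Sum>j\<in>PiE K (\<lambda>k. {1..n k}). 1)"
    unfolding mform_def
  proof (rule sum_norm_le)
    fix j assume j: "j \<in> PiE K (\<lambda>k. {1..n k})"
    have "norm (\<Prod>k\<in>K. x k (j k)) \<le> (\<Prod>k\<in>K. 1)"
      unfolding prod_norm[symmetric] by (intro prod_mono) (use j in \<open>auto intro!: x\<close>)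
    then show "norm (a j * (\<Prod>k\<in>K. x k (j k))) \<le> 1"
      using a[OF j] by (simp add: norm_mult)
  qed
  then show ?thesis by simp
qed

lemma unimodular_form_norm:
  assumes "A \<in> unimodular_forms d n"
  obtains e where "\<And>j. j \<in> PiE {1..d} (\<lambda>k. {1..n k}) \<Longrightarrow> \<bar>e j\<bar> = (1::real)"
    and "A = mform {1..d} n (\<lambda>j. of_real (e j))"
proof -
  obtain \<epsilon> where eps: "\<And>j. j \<in> multi_indices d n \<Longrightarrow> \<epsilon> j \<in> {-1, 1}"
    and A: "A = (\<lambda>x. \<Sum>j\<in>multi_indices d n. \<epsilon> j * (\<Prod>k=1..d. x k (j k)))"
    using assms unfolding unimodular_forms_def by blast
  let ?e = "\<lambda>j. if \<epsilon> j = 1 then 1 else - 1 :: real"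
  have "\<epsilon> j = of_real (?e j)" if "j \<in> multi_indices d n" for j
    using eps[OF that] by auto
  then have "A = mform {1..d} n (\<lambda>j. of_real (?e j))"
    unfolding A mform_def multi_indices_def[symmetric] by (auto simp: fun_eq_iff intro!: sum.cong)
  then show thesis using that[of ?e] by simp
qed

lemma mform_of_real:
  "mform K n (\<lambda>j. of_real (e j)) (\<lambda>k i. of_real (x k i) :: 'k::real_normed_field) = of_real (mform K n e x)"
  by (simp add: mform_def)

lemma mform_scale:
  "mform K n a (\<lambda>k i. c k * x k i) = (\<Prod>k\<in>K. c k) * mform K n a x"
  by (simp add: mform_def prod.distrib sum_distrib_left mult_ac)

lemma form_norm_bdd:
  assumes "A \<in> unimodular_forms d n" "\<And>k. k \<in> {1..d} \<Longrightarrow> 2 \<le> p k"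
  shows "bdd_above ((\<lambda>x. norm (A x)) ` {x. \<forall>k\<in>{1..d}. lp_norm (p k) (n k) (x k) \<le> 1})"
  using assms(1)
proof (rule unimodular_form_norm)
  fix e assume e: "\<And>j. j \<in> PiE {1..d} (\<lambda>k. {1..n k}) \<Longrightarrow> \<bar>e j\<bar> = (1::real)"
    and A: "A = mform {1..d} n (\<lambda>j. of_real (e j))"
  have "norm (A x) \<le> card (PiE {1..d} (\<lambda>k. {1..n k}))"
    if "\<forall>k\<in>{1..d}. lp_norm (p k) (n k) (x k) \<le> 1" for x
    unfolding A
  proof (rule mform_norm_le)
    show "norm (x k i) \<le> 1" if "k \<in> {1..d}" "i \<in> {1..n k}" for k i
      using norm_le_lp_norm[OF assms(2)[OF that(1)] _ that(2)] that(1)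
        \<open>\<forall>k\<in>{1..d}. lp_norm (p k) (n k) (x k) \<le> 1\<close> by blast
  qed (simp add: e)
  then show ?thesis by (intro bdd_aboveI2) auto
qed

text \<open>
  Rescaling the signs of \<open>exists_signs_large\<close> by \<open>n k powr (- recip (p k))\<close> gives admissible vectors. All
  slots then contribute \<open>n k powr (1/2 - recip (p k))\<close>, and slot \<open>m\<close> another \<open>sqrt (n m)\<close>.
\<close>

lemma form_norm_ge:
  fixes A :: "(nat \<Rightarrow> nat \<Rightarrow> 'k::real_normed_field) \<Rightarrow> 'k"
  assumes A: "A \<in> unimodular_forms d n"
    and p: "\<And>k. k \<in> {1..d} \<Longrightarrow> 2 \<le> p k" and n: "\<And>k. k \<in> {1..d} \<Longrightarrow> 1 \<le> n k"
    and m: "m \<in> {1..d}"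
  shows "sqrt (n m) * (\<Prod>k=1..d. n k powr (1/2 - recip (p k))) / sqrt 2 ^ (d - 1) \<le> form_norm d n p A"
  using A
proof (rule unimodular_form_norm)
  fix e assume e: "\<And>j. j \<in> PiE {1..d} (\<lambda>k. {1..n k}) \<Longrightarrow> \<bar>e j\<bar> = (1::real)"
    and A_eq: "A = mform {1..d} n (\<lambda>j. of_real (e j))"
  have split: "insert m ({1..d} - {m}) = {1..d}" using m by auto
  obtain x where x: "\<And>k i. k \<in> {1..d} \<Longrightarrow> i \<in> {1..n k} \<Longrightarrow> \<bar>x k i\<bar> = (1::real)"
    and large: "n m * (\<Prod>l\<in>{1..d} - {m}. sqrt (n l)) / sqrt 2 ^ (d - 1) \<le> mform {1..d} n e x"
    using exists_signs_large[of "{1..d} - {m}" m n e] e m unfolding split by auto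
  have root: "n m * (\<Prod>l\<in>{1..d} - {m}. sqrt (n l)) = sqrt (n m) * (\<Prod>k=1..d. sqrt (n k))"
  proof -
    have "(\<Prod>k=1..d. sqrt (n k)) = sqrt (n m) * (\<Prod>l\<in>{1..d} - {m}. sqrt (n l))"
      using m by (intro prod.remove) auto
    then show ?thesis by simp
  qed
  define c where "c = (\<lambda>k. real (n k) powr (- recip (p k)))"
  let ?y = "\<lambda>k i. of_real (c k * x k i) :: 'k"
  have "norm (A ?y) = (\<Prod>k=1..d. c k) * \<bar>mform {1..d} n e x\<bar>"
    unfolding A_eq mform_of_real mform_scale norm_of_real by (simp add: abs_mult abs_prod c_def)
  moreover have "norm (A ?y) \<le> form_norm d n p A"
    unfolding form_norm_def
  proof (rule cSUP_upper[OF _ form_norm_bdd[OF A p]])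
    show "?y \<in> {x. \<forall>k\<in>{1..d}. lp_norm (p k) (n k) (x k) \<le> 1}"
    proof (intro CollectI ballI)
      fix k assume k: "k \<in> {1..d}"
      have "lp_norm (p k) (n k) (?y k) = 1"
        by (rule lp_norm_constant_modulus[OF p[OF k] n[OF k]])
          (simp only: norm_of_real, simp only: abs_mult x[OF k], simp add: c_def)
      then show "lp_norm (p k) (n k) (?y k) \<le> 1" by simp
    qed
  qed
  moreover have "(\<Prod>k=1..d. c k) * (sqrt (n m) * (\<Prod>k=1..d. sqrt (n k)) / sqrt 2 ^ (d - 1))
      \<le> (\<Prod>k=1..d. c k) * \<bar>mform {1..d} n e x\<bar>"
    using large unfolding root by (intro mult_left_mono prod_nonneg) (auto simp: c_def)
  moreover have "sqrt (n m) * (\<Prod>k=1..d. n k powr (1/2 - recip (p k))) / sqrt 2 ^ (d - 1)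
      = (\<Prod>k=1..d. c k) * (sqrt (n m) * (\<Prod>k=1..d. sqrt (n k)) / sqrt 2 ^ (d - 1))"
  proof -
    have "(\<Prod>k=1..d. c k) * (\<Prod>k=1..d. sqrt (n k)) = (\<Prod>k=1..d. n k powr (1/2 - recip (p k)))"
      unfolding prod.distrib[symmetric]
      by (intro prod.cong refl) (simp add: c_def powr_half_sqrt[symmetric] powr_add[symmetric])
    from this[symmetric] show ?thesis by (simp only: mult_ac times_divide_eq_right)
  qed
  ultimately show ?thesis by linarith
qed

lemma normalized_norm_ge:
  fixes A :: "(nat \<Rightarrow> nat \<Rightarrow> 'k::real_normed_field) \<Rightarrow> 'k"
  assumes d: "1 \<le> d" and A: "A \<in> unimodular_forms d n"
    and p: "\<And>k. k \<in> {1..d} \<Longrightarrow> 2 \<le> p k" and n: "\<And>k. k \<in> {1..d} \<Longrightarrow> 1 \<le> n k"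
  shows "1 / (real d * 2 powr ((real d - 1) / 2)) \<le> normalized_norm d n p A"
proof -
  define P where "P = (\<Prod>k=1..d. real (n k) powr (1/2 - recip (p k)))"
  define S where "S = (\<Sum>k=1..d. real (n k) powr (1/2))"
  \<comment> \<open>The slot of largest dimension loses at most the factor d against the sum of the roots.\<close>
  have "finite (n ` {1..d})" "n ` {1..d} \<noteq> {}" using d by auto
  then obtain m where m: "m \<in> {1..d}" and max: "\<And>k. k \<in> {1..d} \<Longrightarrow> n k \<le> n m"
    using Max_in[of "n ` {1..d}"] Max_ge[of "n ` {1..d}"] by (metis imageE imageI)
  have "S \<le> (\<Sum>k=1..d. sqrt (n m))"
    unfolding S_def by (intro sum_mono) (auto simp: powr_half_sqrt max)
  then have S: "S \<le> real d * sqrt (n m)" by simp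
  have "0 < real (n k) powr (1/2)" if "k \<in> {1..d}" for k
    using n[OF that] by simp
  then have S_pos: "0 < S"
    unfolding S_def using d by (intro sum_pos) auto
  have P_pos: "0 < P"
    unfolding P_def using n by (intro prod_pos) force
  have two: "2 powr ((real d - 1) / 2) = sqrt 2 ^ (d - 1)"
    using d by (simp add: powr_half_sqrt[symmetric] powr_power of_nat_diff)
  have "1 / (real d * 2 powr ((real d - 1) / 2)) \<le> sqrt (n m) / (S * sqrt 2 ^ (d - 1))"
    unfolding two using S S_pos d by (simp add: divide_simps mult_ac)
  also have "\<dots> = sqrt (n m) * P / sqrt 2 ^ (d - 1) / (S * P)"
    using P_pos by simp
  also have "\<dots> \<le> form_norm d n p A / (S * P)"
  proof (rule divide_right_mono)
    show "sqrt (n m) * P / sqrt 2 ^ (d - 1) \<le> form_norm d n p A"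
      unfolding P_def using A p n m by (rule form_norm_ge)
  qed (use S_pos P_pos in simp)
  finally show ?thesis unfolding normalized_norm_def S_def P_def .
qed

section \<open>Signs that are small on a finite set of points\<close>

text \<open>
  For \<open>t \<ge> 0\<close> the function \<open>exp (- t\<^sup>2 / 2) * cosh t\<close> is decreasing, because \<open>sinh t \<le> t * cosh t\<close>.
\<close>

lemma cosh_le_exp_half_square: "cosh (x::real) \<le> exp (x\<^sup>2 / 2)"
proof -
  have sinh_le: "sinh t \<le> t * cosh t" if "0 \<le> t" for t :: real
  proof -
    have "(\<lambda>t. t * cosh t - sinh t) 0 \<le> (\<lambda>t. t * cosh t - sinh t) t"
    proof (rule DERIV_nonneg_imp_nondecreasing[OF that])
      fix s :: real assume "0 \<le> s" "s \<le> t"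
      then show "\<exists>y. ((\<lambda>t. t * cosh t - sinh t) has_real_derivative y) (at s) \<and> 0 \<le> y"
        by (intro exI[of _ "s * sinh s"]) (auto intro!: derivative_eq_intros)
    qed
    then show ?thesis by simp
  qed
  have nonneg: "cosh t \<le> exp (t\<^sup>2 / 2)" if "0 \<le> t" for t :: real
  proof -
    have "(\<lambda>t. exp (- (t\<^sup>2 / 2)) * cosh t) 0 \<ge> (\<lambda>t. exp (- (t\<^sup>2 / 2)) * cosh t) t"
    proof (rule DERIV_nonpos_imp_nonincreasing[OF that])
      fix s :: real assume s: "0 \<le> s" "s \<le> t"
      have "((\<lambda>t. exp (- (t\<^sup>2 / 2)) * cosh t) has_real_derivative
          exp (- (s\<^sup>2 / 2)) * (sinh s - s * cosh s)) (at s)"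
        by (auto intro!: derivative_eq_intros simp: algebra_simps)
      moreover have "exp (- (s\<^sup>2 / 2)) * (sinh s - s * cosh s) \<le> 0"
        using sinh_le[OF s(1)] by (simp add: mult_le_0_iff)
      ultimately show "\<exists>y. ((\<lambda>t. exp (- (t\<^sup>2 / 2)) * cosh t) has_real_derivative y) (at s) \<and> y \<le> 0"
        by blast
    qed
    then show ?thesis by (simp add: exp_minus field_simps)
  qed
  show ?thesis using nonneg[of "\<bar>x\<bar>"] by simp
qed

lemma cube_mean_exp:
  assumes "finite J"
  shows "cube_mean J (\<lambda>e. exp (\<Sum>j\<in>J. e j * g j)) = (\<Prod>j\<in>J. cosh (g j))"
proof -
  have "(\<Prod>j\<in>J. 2 * cosh (g j)) = (\<Prod>j\<in>J. \<Sum>b\<in>{-1, 1}. exp (b * g j))"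
    by (intro prod.cong) (auto simp: cosh_def)
  also have "\<dots> = (\<Sum>e\<in>cube J. exp (\<Sum>j\<in>J. e j * g j))"
    using assms by (subst prod_sum_PiE) (simp_all add: cube_def exp_sum)
  finally show ?thesis
    by (simp add: cube_mean_def prod.distrib field_simps)
qed

lemma exists_le_cube_mean:
  assumes "finite J"
  shows "\<exists>e\<in>cube J. F e \<le> cube_mean J F"
proof (rule ccontr)
  assume "\<not> ?thesis"
  then have less: "cube_mean J F < F e" if "e \<in> cube J" for e using that by force
  have "cube J \<noteq> {}" using card_cube[OF assms] by force
  then have "(\<Sum>e\<in>cube J. cube_mean J F) < (\<Sum>e\<in>cube J. F e)"
    by (intro sum_strict_mono finite_cube assms less)
  then show False
    by (simp add: cube_mean_def card_cube assms)
qed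

text \<open>
  A union bound with exponential moments: some choice of signs keeps \<open>\<Sum>y\<in>Y. exp (l * (\<Sum>j\<in>J. e j * g y j))\<close>
  below its mean, which is at most \<open>card Y * exp (l\<^sup>2 / 2)\<close>, and each summand is below the sum.
\<close>

lemma exists_signs_small_on_finite:
  assumes "finite J" "finite Y" "0 < \<Lambda>" "real (card Y) \<le> exp \<Lambda>"
    and var: "\<And>y. y \<in> Y \<Longrightarrow> (\<Sum>j\<in>J. (g y j)\<^sup>2) \<le> 1"
  shows "\<exists>e\<in>cube J. \<forall>y\<in>Y. (\<Sum>j\<in>J. e j * g y j) \<le> sqrt (2 * \<Lambda>)"
proof -
  \<comment> \<open>The resulting bound \<Lambda> / l + l / 2 is minimal for this l.\<close>
  define l where "l = sqrt (2 * \<Lambda>)"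
  have l: "0 < l" "l\<^sup>2 = 2 * \<Lambda>" using assms(3) by (simp_all add: l_def)
  define G where "G = (\<lambda>y e. exp (\<Sum>j\<in>J. e j * (l * g y j)))"
  have mean: "cube_mean J (G y) \<le> exp \<Lambda>" if "y \<in> Y" for y
  proof -
    have "cube_mean J (G y) = (\<Prod>j\<in>J. cosh (l * g y j))"
      unfolding G_def by (rule cube_mean_exp[OF assms(1)])
    also have "\<dots> \<le> (\<Prod>j\<in>J. exp ((l * g y j)\<^sup>2 / 2))"
      by (intro prod_mono conjI cosh_le_exp_half_square) auto
    also have "\<dots> = exp (\<Lambda> * (\<Sum>j\<in>J. (g y j)\<^sup>2))"
      by (simp add: exp_sum[OF assms(1), symmetric] power_mult_distrib l sum_distrib_left)
    also have "\<dots> \<le> exp \<Lambda>" using var[OF that] assms(3) by simp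
    finally show ?thesis .
  qed
  obtain e where e: "e \<in> cube J" "(\<Sum>y\<in>Y. G y e) \<le> cube_mean J (\<lambda>e. \<Sum>y\<in>Y. G y e)"
    using exists_le_cube_mean[OF assms(1), of "\<lambda>e. \<Sum>y\<in>Y. G y e"] by blast
  have "(\<Sum>j\<in>J. e j * g y j) \<le> l" if "y \<in> Y" for y
  proof -
    have "G y e \<le> (\<Sum>y\<in>Y. G y e)"
      using that assms(2) by (intro member_le_sum) (auto simp: G_def)
    also have "\<dots> \<le> (\<Sum>y\<in>Y. exp \<Lambda>)"
      using e(2) unfolding cube_mean_sum by (rule order_trans) (intro sum_mono mean)
    also have "\<dots> \<le> exp \<Lambda> * exp \<Lambda>" using assms(4) by simp
    also have "\<dots> = exp (l * l)" using l by (simp add: exp_add[symmetric] power2_eq_square)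
    finally have "l * (\<Sum>j\<in>J. e j * g y j) \<le> l * l"
      by (simp add: G_def sum_distrib_left mult_ac)
    then show ?thesis using l by simp
  qed
  then show ?thesis using e(1) unfolding l_def by blast
qed

section \<open>A net of the complex Euclidean ball\<close>

text \<open>
  The parameter satisfies \<open>q / (1 - q) = r\<close>, so that \<open>1 + 2 r\<close> is the value of the full two-sided
  geometric series.
\<close>

lemma sum_power_abs_le:
  assumes "1 \<le> (r::nat)"
  defines "q \<equiv> real r / (1 + r)"
  shows "(\<Sum>z\<in>{- int R..int R}. q ^ nat \<bar>z\<bar>) \<le> 1 + 2 * real r"
proof -
  \<comment> \<open>The summand 2 r q^R is the tail of the series.\<close>
  have "(\<Sum>z\<in>{- int R..int R}. q ^ nat \<bar>z\<bar>) + 2 * r * q ^ R = 1 + 2 * real r"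
  proof (induction R)
    case 0
    then show ?case by simp
  next
    case (Suc R)
    have "{- int (Suc R)..int (Suc R)} = insert (int (Suc R)) (insert (- int (Suc R)) {- int R..int R})"
      by auto
    then have "(\<Sum>z\<in>{- int (Suc R)..int (Suc R)}. q ^ nat \<bar>z\<bar>)
        = 2 * q ^ Suc R + (\<Sum>z\<in>{- int R..int R}. q ^ nat \<bar>z\<bar>)"
      by (simp add: nat_add_distrib add.commute)
    moreover have "(1 + real r) * q ^ Suc R = r * q ^ R"
      by (simp add: q_def)
    ultimately show ?case using Suc.IH by (simp add: algebra_simps)
  qed
  moreover have "0 \<le> 2 * r * q ^ R" by (simp add: q_def)
  ultimately show ?thesis by linarith
qed

text \<open>
  Vectors of Gaussian integers, given by real and imaginary parts, in an \<open>\<ell>\<^sub>1\<close> ball of \<open>\<real>\<^sup>2\<^sup>n\<close>. The box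
  that contains the entries makes the set visibly finite.
\<close>

definition grid :: "nat \<Rightarrow> nat \<Rightarrow> (nat \<Rightarrow> int \<times> int) set" where
  "grid n R = {w \<in> PiE {1..n} (\<lambda>_. {- int R..int R} \<times> {- int R..int R}).
     (\<Sum>i=1..n. \<bar>fst (w i)\<bar> + \<bar>snd (w i)\<bar>) \<le> int R}"

lemma finite_grid: "finite (grid n R)"
  unfolding grid_def by (intro finite_Collect_conjI disjI1) (simp add: finite_PiE)

text \<open>
  Each point of the grid has weight at least \<open>q ^ (2 n r)\<close> when an integer \<open>z\<close> is weighted with \<open>q ^ |z|\<close>,
  and the total weight of \<open>\<int>\<^sup>2\<^sup>n\<close> is at most \<open>(1 + 2 r) ^ (2 n)\<close>. For \<open>q = r / (1 + r)\<close> the factor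
  \<open>q ^ (- r) = (1 + 1 / r) ^ r\<close> is at most \<open>e\<close>.
\<close>

lemma card_grid_le:
  assumes r: "1 \<le> (r::nat)"
  shows "real (card (grid n (2 * n * r))) \<le> (exp 1 * (1 + 2 * real r)) ^ (2 * n)"
proof -
  define q where "q = real r / (1 + r)"
  define R where "R = 2 * n * r"
  define B where "B = {- int R..int R}"
  have q: "0 < q" "q \<le> 1" using r by (simp_all add: q_def)
  have "real (card (grid n R)) * q ^ R = (\<Sum>w\<in>grid n R. q ^ R)" by simp
  also have "\<dots> \<le> (\<Sum>w\<in>grid n R. q ^ (\<Sum>i=1..n. nat \<bar>fst (w i)\<bar> + nat \<bar>snd (w i)\<bar>))"
  proof (rule sum_mono)
    fix w assume "w \<in> grid n R"
    then have "int (\<Sum>i=1..n. nat \<bar>fst (w i)\<bar> + nat \<bar>snd (w i)\<bar>) \<le> int R"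
      by (simp add: grid_def)
    then have "(\<Sum>i=1..n. nat \<bar>fst (w i)\<bar> + nat \<bar>snd (w i)\<bar>) \<le> R"
      by (simp only: of_nat_le_iff)
    then show "q ^ R \<le> q ^ (\<Sum>i=1..n. nat \<bar>fst (w i)\<bar> + nat \<bar>snd (w i)\<bar>)"
      using q by (intro power_decreasing) auto
  qed
  also have "\<dots> \<le> (\<Sum>w\<in>PiE {1..n} (\<lambda>_. B \<times> B). q ^ (\<Sum>i=1..n. nat \<bar>fst (w i)\<bar> + nat \<bar>snd (w i)\<bar>))"
    using q by (intro sum_mono2) (auto simp: grid_def B_def finite_PiE)
  also have "\<dots> = (\<Sum>w\<in>PiE {1..n} (\<lambda>_. B \<times> B). \<Prod>i\<in>{1..n}. q ^ nat \<bar>fst (w i)\<bar> * q ^ nat \<bar>snd (w i)\<bar>)"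
    by (simp add: power_sum power_add)
  also have "\<dots> = (\<Prod>i\<in>{1..n}. \<Sum>p\<in>B \<times> B. q ^ nat \<bar>fst p\<bar> * q ^ nat \<bar>snd p\<bar>)"
    by (subst prod_sum_PiE) (simp_all add: B_def)
  also have "\<dots> = ((\<Sum>z\<in>B. q ^ nat \<bar>z\<bar>)\<^sup>2) ^ n"
    by (simp add: sum.cartesian_product' power2_eq_square sum_product)
  also have "\<dots> \<le> ((1 + 2 * real r)\<^sup>2) ^ n"
    using sum_power_abs_le[OF r, of R] q
    by (intro power_mono) (auto simp: q_def B_def intro!: sum_nonneg)
  finally have count: "real (card (grid n R)) * q ^ R \<le> (1 + 2 * real r) ^ (2 * n)"
    by (simp add: power_mult)
  have "1 / q = 1 + 1 / real r" using r by (simp add: q_def field_simps)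
  also have "\<dots> \<le> exp (1 / real r)" by simp
  finally have "(1 / q) ^ R \<le> exp (1 / real r) ^ R"
    using q by (intro power_mono) auto
  also have "\<dots> = exp 1 ^ (2 * n)"
    using r by (simp add: R_def exp_of_nat_mult[symmetric])
  finally have "1 \<le> exp 1 ^ (2 * n) * q ^ R"
    using q by (simp add: power_divide field_simps)
  then have "real (card (grid n R)) \<le> real (card (grid n R)) * (exp 1 ^ (2 * n) * q ^ R)"
    using mult_left_mono[of 1 "exp 1 ^ (2 * n) * q ^ R" "real (card (grid n R))"] by simp
  also have "\<dots> \<le> exp 1 ^ (2 * n) * (1 + 2 * real r) ^ (2 * n)"
    using mult_left_mono[OF count, of "exp 1 ^ (2 * n)"] by (simp add: mult_ac)
  finally show ?thesis by (simp add: power_mult_distrib R_def)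
qed

definition l2 :: "nat \<Rightarrow> (nat \<Rightarrow> 'k::real_normed_field) \<Rightarrow> real" where
  "l2 n x = L2_set (\<lambda>i. norm (x i)) {1..n}"

text \<open>
  Rounding towards zero, so that rounded vectors stay in the ball.
\<close>

definition trunc :: "real \<Rightarrow> int" where
  "trunc u = (if 0 \<le> u then \<lfloor>u\<rfloor> else \<lceil>u\<rceil>)"

lemma abs_trunc_le: "\<bar>real_of_int (trunc u)\<bar> \<le> \<bar>u\<bar>"
  by (cases "0 \<le> u"; simp add: trunc_def; linarith)

lemma abs_diff_trunc_le: "\<bar>u - real_of_int (trunc u)\<bar> \<le> 1"
  by (cases "0 \<le> u"; simp add: trunc_def; linarith)

text \<open>
  The net consists of the points of a grid of width \<open>h\<close> in the unit ball. Rounding moves each of the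
  \<open>2 n\<close> real coordinates by at most \<open>h\<close>, thus the vector by at most \<open>h * sqrt (2 n) = 1 / r\<close>. By the
  Cauchy-Schwarz inequality a point of the unit ball has an \<open>\<ell>\<^sub>1\<close> norm of at most \<open>sqrt (2 n) = 2 n r h\<close> in
  these coordinates, which makes \<open>card_grid_le\<close> applicable.
\<close>

lemma ball_net:
  assumes n: "1 \<le> n" and r: "1 \<le> r"
  obtains Y :: "(nat \<Rightarrow> complex) set"
  where "finite Y" "real (card Y) \<le> (exp 1 * (1 + 2 * real r)) ^ (2 * n)"
    and "\<And>y. y \<in> Y \<Longrightarrow> l2 n y \<le> 1"
    and "\<And>x. l2 n x \<le> 1 \<Longrightarrow> \<exists>y\<in>Y. l2 n (\<lambda>i. x i - y i) \<le> 1 / real r"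
proof -
  define h where "h = 1 / (real r * sqrt (2 * n))"
  have h: "0 < h" using n r by (simp add: h_def)
  define \<phi> where "\<phi> = (\<lambda>(w :: nat \<Rightarrow> int \<times> int) i. Complex (h * real_of_int (fst (w i))) (h * real_of_int (snd (w i))))"
  define Y where "Y = \<phi> ` grid n (2 * n * r) \<inter> {y. l2 n y \<le> 1}"
  show thesis
  proof (rule that)
    show "finite Y" unfolding Y_def using finite_grid by blast
    have "card Y \<le> card (\<phi> ` grid n (2 * n * r))"
      unfolding Y_def by (intro card_mono finite_imageI finite_grid) auto
    also have "\<dots> \<le> card (grid n (2 * n * r))" by (rule card_image_le[OF finite_grid])
    finally show "real (card Y) \<le> (exp 1 * (1 + 2 * real r)) ^ (2 * n)"
      using card_grid_le[OF r, of n] by linarith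
    show "l2 n y \<le> 1" if "y \<in> Y" for y using that by (simp add: Y_def)
  next
    fix x :: "nat \<Rightarrow> complex" assume x: "l2 n x \<le> 1"
    define w where "w = (\<lambda>i\<in>{1..n}. (trunc (Re (x i) / h), trunc (Im (x i) / h)))"
    have Re: "\<bar>Re (\<phi> w i)\<bar> \<le> \<bar>Re (x i)\<bar>" "\<bar>Re (x i - \<phi> w i)\<bar> \<le> h"
      and Im: "\<bar>Im (\<phi> w i)\<bar> \<le> \<bar>Im (x i)\<bar>" "\<bar>Im (x i - \<phi> w i)\<bar> \<le> h" if "i \<in> {1..n}" for i
    proof -
      have "\<bar>h * trunc (u / h)\<bar> \<le> \<bar>u\<bar> \<and> \<bar>u - h * trunc (u / h)\<bar> \<le> h" for u
      proof -
        have "\<bar>h * trunc (u / h)\<bar> \<le> h * \<bar>u / h\<bar>"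
          using mult_left_mono[OF abs_trunc_le[of "u / h"], of h] h by (simp add: abs_mult)
        moreover have "h * \<bar>u / h - trunc (u / h)\<bar> \<le> h"
          using mult_left_mono[OF abs_diff_trunc_le[of "u / h"], of h] h by simp
        moreover have "h * \<bar>u / h - trunc (u / h)\<bar> = \<bar>u - h * trunc (u / h)\<bar>"
        proof -
          have "u - h * trunc (u / h) = h * (u / h - trunc (u / h))"
            using h by (simp add: right_diff_distrib)
          then show ?thesis using h by (simp only: abs_mult abs_of_pos)
        qed
        ultimately show ?thesis using h by simp
      qed
      then show "\<bar>Re (\<phi> w i)\<bar> \<le> \<bar>Re (x i)\<bar>" "\<bar>Re (x i - \<phi> w i)\<bar> \<le> h"
        "\<bar>Im (\<phi> w i)\<bar> \<le> \<bar>Im (x i)\<bar>" "\<bar>Im (x i - \<phi> w i)\<bar> \<le> h"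
        using that by (simp_all add: \<phi>_def w_def)
    qed
    have "l2 n (\<phi> w) \<le> l2 n x"
      unfolding l2_def
    proof (rule L2_set_mono)
      fix i assume "i \<in> {1..n}"
      then show "cmod (\<phi> w i) \<le> cmod (x i)"
        unfolding cmod_def using Re(1)[of i] Im(1)[of i]
        by (intro real_sqrt_le_mono add_mono) (auto simp: abs_le_square_iff)
    qed simp
    moreover have "w \<in> grid n (2 * n * r)"
    proof -
      have "real_of_int (\<Sum>i=1..n. \<bar>fst (w i)\<bar> + \<bar>snd (w i)\<bar>)
          \<le> (\<Sum>i=1..n. sqrt 2 / h * cmod (x i))"
        unfolding of_int_sum
      proof (rule sum_mono)
        fix i assume i: "i \<in> {1..n}"
        have "h * (\<bar>real_of_int (fst (w i))\<bar> + \<bar>real_of_int (snd (w i))\<bar>) = \<bar>Re (\<phi> w i)\<bar> + \<bar>Im (\<phi> w i)\<bar>"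
          using h by (simp add: \<phi>_def abs_mult distrib_left)
        also have "\<dots> \<le> \<bar>Re (x i)\<bar> + \<bar>Im (x i)\<bar>"
          using Re(1)[OF i] Im(1)[OF i] by simp
        also have "\<dots> \<le> sqrt 2 * cmod (x i)" by (rule complex_abs_le_norm)
        finally show "real_of_int (\<bar>fst (w i)\<bar> + \<bar>snd (w i)\<bar>) \<le> sqrt 2 / h * cmod (x i)"
          using h by (simp add: field_simps)
      qed
      also have "\<dots> = sqrt 2 / h * (\<Sum>i=1..n. \<bar>cmod (x i)\<bar> * \<bar>1\<bar>)"
        by (simp add: sum_distrib_left)
      also have "\<dots> \<le> sqrt 2 / h * (L2_set (\<lambda>i. cmod (x i)) {1..n} * L2_set (\<lambda>_. 1) {1..n})"
        using h by (intro mult_left_mono L2_set_mult_ineq) auto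
      also have "\<dots> \<le> sqrt 2 / h * (1 * sqrt n)"
        using x h by (intro mult_left_mono mult_mono) (auto simp: l2_def L2_set_constant)
      also have "\<dots> = real_of_int (int (2 * n * r))"
        by (simp add: h_def real_sqrt_mult mult_ac)
      finally have le: "(\<Sum>i=1..n. \<bar>fst (w i)\<bar> + \<bar>snd (w i)\<bar>) \<le> int (2 * n * r)"
        by (simp only: of_int_le_iff)
      have "\<bar>fst (w i)\<bar> + \<bar>snd (w i)\<bar> \<le> int (2 * n * r)" if "i \<in> {1..n}" for i
        using member_le_sum[OF that, of "\<lambda>i. \<bar>fst (w i)\<bar> + \<bar>snd (w i)\<bar>"] le by force
      then have "w i \<in> {- int (2 * n * r)..int (2 * n * r)} \<times> {- int (2 * n * r)..int (2 * n * r)}"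
        if "i \<in> {1..n}" for i
        using that by (cases "w i") force
      then show ?thesis
        using le unfolding grid_def by (auto simp: w_def)
    qed
    ultimately have "\<phi> w \<in> Y" using x by (simp add: Y_def)
    moreover have "l2 n (\<lambda>i. x i - \<phi> w i) \<le> 1 / real r"
    proof -
      have "l2 n (\<lambda>i. x i - \<phi> w i) \<le> L2_set (\<lambda>_. sqrt 2 * h) {1..n}"
        unfolding l2_def
      proof (rule L2_set_mono)
        fix i assume i: "i \<in> {1..n}"
        have "cmod (x i - \<phi> w i) \<le> sqrt (h\<^sup>2 + h\<^sup>2)"
          unfolding cmod_def using Re(2)[OF i] Im(2)[OF i] h
          by (intro real_sqrt_le_mono add_mono) (auto simp: abs_le_square_iff[symmetric])
        also have "\<dots> = sqrt 2 * h" using h by (simp add: real_sqrt_mult)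
        finally show "cmod (x i - \<phi> w i) \<le> sqrt 2 * h" .
      qed simp
      also have "\<dots> = 1 / real r"
        using n h by (simp add: L2_set_constant h_def real_sqrt_mult abs_mult)
      finally show ?thesis .
    qed
    ultimately show "\<exists>y\<in>Y. l2 n (\<lambda>i. x i - y i) \<le> 1 / real r" by blast
  qed
qed

section \<open>From a net to the product of balls\<close>

lemma mform_cong:
  assumes "\<And>k i. k \<in> K \<Longrightarrow> i \<in> {1..n k} \<Longrightarrow> x k i = y k i"
  shows "mform K n a x = mform K n a y"
  unfolding mform_def
proof (rule sum.cong[OF refl])
  fix j assume "j \<in> PiE K (\<lambda>k. {1..n k})"
  then have "(\<Prod>k\<in>K. x k (j k)) = (\<Prod>k\<in>K. y k (j k))"
    by (intro prod.cong assms) auto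
  then show "a j * (\<Prod>k\<in>K. x k (j k)) = a j * (\<Prod>k\<in>K. y k (j k))" by simp
qed

lemma mform_upd:
  assumes "finite K" "m \<in> K"
  shows "mform K n a (x(m := b)) = (\<Sum>i\<in>{1..n m}. b i * mform (K - {m}) n (\<lambda>j. a (j(m := i))) x)"
  using mform_insert[of "K - {m}" m n a x b] assms by (simp add: insert_absorb mform_sum)

lemma mform_upd_diff:
  assumes "finite K" "m \<in> K"
  shows "mform K n a (x(m := b)) - mform K n a (x(m := c)) = mform K n a (x(m := \<lambda>i. b i - c i))"
  using assms by (simp add: mform_upd sum_subtractf left_diff_distrib)

lemma mform_upd_scale:
  assumes "finite K" "m \<in> K"
  shows "mform K n a (x(m := \<lambda>i. c * b i)) = c * mform K n a (x(m := b))"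
  using assms by (simp add: mform_upd sum_distrib_left mult_ac)

lemma l2_scale: "l2 n (\<lambda>i. c * x i) = norm c * l2 n x"
  unfolding l2_def norm_mult by (rule L2_set_right_distrib[symmetric]) simp

lemma norm_le_l2: "i \<in> {1..n} \<Longrightarrow> norm (x i) \<le> l2 n x"
  unfolding l2_def by (rule member_le_L2_set) auto

text \<open>
  Let \<open>M\<close> be the supremum of the form over the product of balls. Replacing the \<open>d\<close> vectors one by one by
  net points at distance at most \<open>1 / (2 d)\<close> changes the value by at most \<open>M / 2\<close> in total, so \<open>M \<le> t + M / 2\<close>.
  Bounding the real part on the net is enough, because a phase in the first slot makes the value of
  the form at any given point real and nonnegative.
\<close>

lemma mform_le_net_bound:
  fixes Y :: "nat \<Rightarrow> (nat \<Rightarrow> complex) set"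
  assumes d: "1 \<le> d"
    and a: "\<And>j. j \<in> PiE {1..d} (\<lambda>k. {1..n k}) \<Longrightarrow> norm (a j) = 1"
    and ball: "\<And>k y. k \<in> {1..d} \<Longrightarrow> y \<in> Y k \<Longrightarrow> l2 (n k) y \<le> 1"
    and net: "\<And>k x. k \<in> {1..d} \<Longrightarrow> l2 (n k) x \<le> 1 \<Longrightarrow> \<exists>y\<in>Y k. l2 (n k) (\<lambda>i. x i - y i) \<le> 1 / (2 * real d)"
    and t: "\<And>y. y \<in> PiE {1..d} Y \<Longrightarrow> Re (mform {1..d} n a y) \<le> t"
    and x: "\<And>k. k \<in> {1..d} \<Longrightarrow> l2 (n k) (x k) \<le> 1"
  shows "cmod (mform {1..d} n a x) \<le> 2 * t"
proof -
  let ?A = "mform {1..d} n a"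
  define S where "S = {x :: nat \<Rightarrow> nat \<Rightarrow> complex. \<forall>k\<in>{1..d}. l2 (n k) (x k) \<le> 1}"
  define M where "M = (SUP x\<in>S. cmod (?A x))"
  have bdd: "bdd_above ((\<lambda>x. cmod (?A x)) ` S)"
  proof (rule bdd_aboveI2)
    fix x assume x: "x \<in> S"
    show "cmod (?A x) \<le> card (PiE {1..d} (\<lambda>k. {1..n k}))"
    proof (rule mform_norm_le[OF a])
      fix k i assume "k \<in> {1..d}" "i \<in> {1..n k}"
      then show "cmod (x k i) \<le> 1"
        using x norm_le_l2[of i "n k" "x k"] unfolding S_def by fastforce
    qed
  qed
  have le_M: "cmod (?A x) \<le> M" if "x \<in> S" for x
    unfolding M_def by (rule cSUP_upper[OF that bdd])
  \<comment> \<open>Homogeneity in slot m: the vector 2 d b lies in the unit ball.\<close>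
  have small: "cmod (?A (x(m := b))) \<le> M / (2 * real d)"
    if "m \<in> {1..d}" "x \<in> S" "l2 (n m) b \<le> 1 / (2 * real d)" for x m b
  proof -
    let ?b = "\<lambda>i. of_real (2 * real d) * b i"
    have "l2 (n m) ?b = 2 * real d * l2 (n m) b"
      unfolding l2_scale norm_of_real by simp
    also have "\<dots> \<le> 1" using that(3) d by (simp add: field_simps)
    finally have "x(m := ?b) \<in> S" using that(2) by (simp add: S_def)
    then have "cmod (of_real (2 * real d) * ?A (x(m := b))) \<le> M"
      using le_M that(1) by (simp only: mform_upd_scale[symmetric] finite_atLeastAtMost)
    then show ?thesis using d by (simp add: norm_mult field_simps)
  qed
  have "cmod (?A x) \<le> t + M / 2" if x: "x \<in> S" for x
  proof -
    \<comment> \<open>The phase that rotates the value of the form to its modulus.\<close>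
    obtain u where u: "cmod u = 1" "u * ?A x = of_real (cmod (?A x))"
    proof (cases "?A x = 0")
      case True
      then show thesis using that[of 1] by simp
    next
      case False
      then show thesis
        using that[of "of_real (cmod (?A x)) / ?A x"] by (simp add: norm_divide)
    qed
    define x' where "x' = x(1 := \<lambda>i. u * x 1 i)"
    have "?A x' = u * ?A (x(1 := x 1))"
      unfolding x'_def using d by (intro mform_upd_scale) auto
    then have Ax': "?A x' = of_real (cmod (?A x))" using u by simp
    have x': "x' \<in> S" using x u by (auto simp: S_def x'_def l2_scale)
    have "\<forall>k. \<exists>y. k \<in> {1..d} \<longrightarrow> y \<in> Y k \<and> l2 (n k) (\<lambda>i. x' k i - y i) \<le> 1 / (2 * real d)"
      using net x' unfolding S_def by blast
    then obtain y where y: "\<And>k. k \<in> {1..d} \<Longrightarrow> y k \<in> Y k"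
      and close: "\<And>k. k \<in> {1..d} \<Longrightarrow> l2 (n k) (\<lambda>i. x' k i - y k i) \<le> 1 / (2 * real d)"
      by metis
    \<comment> \<open>The first l vectors are already replaced by net points.\<close>
    define hyb where "hyb = (\<lambda>l k. if k \<le> l then y k else x' k)"
    have hyb_S: "hyb l \<in> S" for l
      using x' y ball by (auto simp: S_def hyb_def)
    have "cmod (?A (hyb 0) - ?A (hyb l)) \<le> real l * (M / (2 * real d))" if "l \<le> d" for l
      using that
    proof (induction l)
      case 0
      then show ?case by simp
    next
      case (Suc l)
      have m: "Suc l \<in> {1..d}" using Suc.prems by simp
      have "?A (hyb l) = ?A ((hyb l)(Suc l := x' (Suc l)))"
        by (rule arg_cong[where f = ?A]) (auto simp: hyb_def)
      moreover have "?A (hyb (Suc l)) = ?A ((hyb l)(Suc l := y (Suc l)))"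
        by (rule arg_cong[where f = ?A]) (auto simp: hyb_def fun_eq_iff)
      ultimately have "?A (hyb l) - ?A (hyb (Suc l))
          = ?A ((hyb l)(Suc l := \<lambda>i. x' (Suc l) i - y (Suc l) i))"
        using m by (simp only: mform_upd_diff finite_atLeastAtMost)
      then have "cmod (?A (hyb l) - ?A (hyb (Suc l))) \<le> M / (2 * real d)"
        using small[OF m hyb_S close[OF m]] by simp
      moreover have "cmod (?A (hyb 0) - ?A (hyb (Suc l)))
          \<le> cmod (?A (hyb 0) - ?A (hyb l)) + cmod (?A (hyb l) - ?A (hyb (Suc l)))"
        using norm_triangle_ineq[of "?A (hyb 0) - ?A (hyb l)" "?A (hyb l) - ?A (hyb (Suc l))"] by simp
      moreover have "cmod (?A (hyb 0) - ?A (hyb l)) \<le> real l * (M / (2 * real d))"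
        using Suc by simp
      moreover have "real (Suc l) * (M / (2 * real d)) = real l * (M / (2 * real d)) + M / (2 * real d)"
        by (simp only: of_nat_Suc distrib_right mult_1_left add.commute)
      ultimately show ?case by linarith
    qed
    from this[of d] have "cmod (?A (hyb 0) - ?A (hyb d)) \<le> M / 2" using d by simp
    moreover have "?A (hyb 0) = ?A x'" by (rule mform_cong) (simp add: hyb_def)
    moreover have "?A (hyb d) = ?A (restrict y {1..d})"
      by (rule mform_cong) (simp add: hyb_def)
    moreover have "Re (?A (restrict y {1..d})) \<le> t"
      by (rule t) (use y in auto)
    ultimately show ?thesis
      using complex_Re_le_cmod[of "?A x' - ?A (restrict y {1..d})"] Ax' by simp
  qed
  moreover have xS: "x \<in> S" using x by (simp add: S_def)
  ultimately have "M \<le> t + M / 2"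
    unfolding M_def by (intro cSUP_least) auto
  then show ?thesis using le_M[OF xS] by simp
qed

section \<open>The upper bound\<close>

text \<open>
  The product of the nets of mesh \<open>1 / (2 d)\<close> has at most \<open>exp \<Lambda>\<close> points for \<open>\<Lambda> = 4 * (\<Sum>k. n k) * ln (1 + 4 d)\<close>,
  where \<open>e \<le> 1 + 4 d\<close> merges the two factors in the base of \<open>card_grid_le\<close>. This leads to the bound
  \<open>2 * sqrt (2 * \<Lambda>) = sqrt 32 * sqrt (ln (1 + 4 d)) * sqrt (\<Sum>k. n k)\<close>.
\<close>

lemma exists_signs_small:
  assumes d: "1 \<le> d" and n: "\<And>k. k \<in> {1..d} \<Longrightarrow> 1 \<le> n k"
  obtains e where "\<And>j. j \<in> PiE {1..d} (\<lambda>k. {1..n k}) \<Longrightarrow> e j = 1 \<or> e j = (-1::real)"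
    and "\<And>x. (\<And>k. k \<in> {1..d} \<Longrightarrow> l2 (n k) (x k) \<le> 1) \<Longrightarrow>
      cmod (mform {1..d} n (\<lambda>j. of_real (e j)) x) \<le> 8 * sqrt (ln (1 + 4 * real d)) * (\<Sum>k=1..d. sqrt (n k))"
proof -
  define J where "J = PiE {1..d} (\<lambda>k. {1..n k})"
  define L where "L = ln (1 + 4 * real d)"
  define N where "N = (\<Sum>k=1..d. n k)"
  define \<Lambda> where "\<Lambda> = 4 * real N * L"
  have L: "0 < L" using d by (simp add: L_def)
  have "n 1 \<le> N" unfolding N_def using d by (intro member_le_sum) auto
  then have \<Lambda>: "0 < \<Lambda>" using n[of 1] d L by (simp add: \<Lambda>_def)
  define net where "net = (\<lambda>k (Y :: (nat \<Rightarrow> complex) set).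
      finite Y \<and> real (card Y) \<le> (exp 1 * (1 + 4 * real d)) ^ (2 * n k) \<and> (\<forall>y\<in>Y. l2 (n k) y \<le> 1) \<and>
      (\<forall>x. l2 (n k) x \<le> 1 \<longrightarrow> (\<exists>y\<in>Y. l2 (n k) (\<lambda>i. x i - y i) \<le> 1 / (2 * real d))))"
  have "\<forall>k\<in>{1..d}. \<exists>Y. net k Y"
  proof
    fix k assume "k \<in> {1..d}"
    then have "1 \<le> n k" by (rule n)
    moreover have "1 \<le> 2 * d" using d by simp
    ultimately obtain Y :: "(nat \<Rightarrow> complex) set"
      where "finite Y" "real (card Y) \<le> (exp 1 * (1 + 2 * real (2 * d))) ^ (2 * n k)"
        and "\<And>y. y \<in> Y \<Longrightarrow> l2 (n k) y \<le> 1"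
        and "\<And>x. l2 (n k) x \<le> 1 \<Longrightarrow> \<exists>y\<in>Y. l2 (n k) (\<lambda>i. x i - y i) \<le> 1 / real (2 * d)"
      by (rule ball_net) blast
    then show "\<exists>Y. net k Y"
      unfolding net_def by (intro exI[of _ Y]) simp
  qed
  then obtain Y where "\<forall>k\<in>{1..d}. net k (Y k)" using bchoice[of "{1..d}" net] by blast
  then have Y: "finite (Y k)" "real (card (Y k)) \<le> (exp 1 * (1 + 4 * real d)) ^ (2 * n k)"
    "\<And>y. y \<in> Y k \<Longrightarrow> l2 (n k) y \<le> 1"
    "\<And>x. l2 (n k) x \<le> 1 \<Longrightarrow> \<exists>y\<in>Y k. l2 (n k) (\<lambda>i. x i - y i) \<le> 1 / (2 * real d)"
    if "k \<in> {1..d}" for k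
    using that unfolding net_def by blast+
  have exp_L: "exp L = 1 + 4 * real d" using d by (simp add: L_def)
  have "exp 1 \<le> exp L" unfolding exp_L using d exp_le by linarith
  have "real (card (PiE {1..d} Y)) = (\<Prod>k=1..d. real (card (Y k)))"
    by (simp add: card_PiE)
  also have "\<dots> \<le> (\<Prod>k=1..d. (exp L * exp L) ^ (2 * n k))"
  proof (intro prod_mono conjI)
    fix k assume "k \<in> {1..d}"
    then have "real (card (Y k)) \<le> (exp 1 * exp L) ^ (2 * n k)" using Y(2) exp_L by simp
    also have "\<dots> \<le> (exp L * exp L) ^ (2 * n k)"
      using \<open>exp 1 \<le> exp L\<close> by (intro power_mono mult_right_mono) auto
    finally show "real (card (Y k)) \<le> (exp L * exp L) ^ (2 * n k)" .
  qed simp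
  also have "\<dots> = (exp L * exp L) ^ (2 * N)"
    by (simp add: N_def power_sum sum_distrib_left)
  also have "\<dots> = exp \<Lambda>"
  proof -
    have "(exp L * exp L) ^ (2 * N) = exp (real (2 * N) * (L + L))"
      by (simp only: exp_of_nat_mult exp_add)
    then show ?thesis by (simp add: \<Lambda>_def)
  qed
  finally have card: "real (card (PiE {1..d} Y)) \<le> exp \<Lambda>" .
  define g where "g = (\<lambda>(y :: nat \<Rightarrow> nat \<Rightarrow> complex) j. Re (\<Prod>k=1..d. y k (j k)))"
  have "\<exists>e\<in>cube J. \<forall>y\<in>PiE {1..d} Y. (\<Sum>j\<in>J. e j * g y j) \<le> sqrt (2 * \<Lambda>)"
  proof (rule exists_signs_small_on_finite[OF _ _ \<Lambda> card])
    fix y assume y: "y \<in> PiE {1..d} Y"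
    \<comment> \<open>The variance is at most the product of the squared Euclidean norms.\<close>
    have "(\<Sum>j\<in>J. (g y j)\<^sup>2) \<le> (\<Sum>j\<in>J. \<Prod>k=1..d. (cmod (y k (j k)))\<^sup>2)"
    proof (rule sum_mono)
      fix j
      have "(g y j)\<^sup>2 \<le> (cmod (\<Prod>k=1..d. y k (j k)))\<^sup>2"
        unfolding g_def using abs_Re_le_cmod by (metis abs_ge_zero power2_abs power_mono)
      also have "\<dots> = (\<Prod>k=1..d. (cmod (y k (j k)))\<^sup>2)"
        by (simp add: prod_norm[symmetric] prod_power_distrib)
      finally show "(g y j)\<^sup>2 \<le> (\<Prod>k=1..d. (cmod (y k (j k)))\<^sup>2)" .
    qed
    also have "\<dots> = (\<Prod>k=1..d. \<Sum>i=1..n k. (cmod (y k i))\<^sup>2)"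
      unfolding J_def by (subst prod_sum_PiE) auto
    also have "\<dots> \<le> (\<Prod>k=1..d. 1)"
    proof (intro prod_mono conjI)
      fix k assume k: "k \<in> {1..d}"
      then have "y k \<in> Y k" using y by auto
      then have "l2 (n k) (y k) \<le> 1" by (rule Y(3)[OF k])
      then show "(\<Sum>i=1..n k. (cmod (y k i))\<^sup>2) \<le> 1"
        by (simp add: l2_def L2_set_def)
    qed (simp add: sum_nonneg)
    finally show "(\<Sum>j\<in>J. (g y j)\<^sup>2) \<le> 1" by simp
  qed (use Y(1) in \<open>auto simp: J_def intro!: finite_PiE\<close>)
  then obtain e where e: "e \<in> cube J"
    and le: "\<And>y. y \<in> PiE {1..d} Y \<Longrightarrow> (\<Sum>j\<in>J. e j * g y j) \<le> sqrt (2 * \<Lambda>)"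
    by blast
  have bound: "2 * sqrt (2 * \<Lambda>) \<le> 8 * sqrt L * (\<Sum>k=1..d. sqrt (n k))"
  proof -
    have "sqrt (real N) = L2_set (\<lambda>k. sqrt (n k)) {1..d}"
      by (simp add: N_def L2_set_def)
    also have "\<dots> \<le> (\<Sum>k=1..d. sqrt (n k))"
      by (rule L2_set_le_sum) simp
    finally have N: "sqrt (real N) \<le> (\<Sum>k=1..d. sqrt (n k))" .
    have "2 * sqrt (2 * \<Lambda>) = sqrt 4 * sqrt (8 * (real N * L))"
      by (simp add: \<Lambda>_def)
    also have "\<dots> = sqrt (32 * L * real N)"
      unfolding real_sqrt_mult[symmetric] by (simp add: mult_ac)
    also have "\<dots> = sqrt 32 * sqrt L * sqrt (real N)"
      unfolding real_sqrt_mult ..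
    also have "\<dots> \<le> 8 * sqrt L * (\<Sum>k=1..d. sqrt (n k))"
      using N L by (intro mult_mono) (auto intro!: real_le_lsqrt sum_nonneg)
    finally show ?thesis .
  qed
  show thesis
  proof (rule that[of e])
    show "e j = 1 \<or> e j = -1" if "j \<in> PiE {1..d} (\<lambda>k. {1..n k})" for j
      using cube_memD[OF e] that by (simp add: J_def)
    fix x :: "nat \<Rightarrow> nat \<Rightarrow> complex" assume x: "\<And>k. k \<in> {1..d} \<Longrightarrow> l2 (n k) (x k) \<le> 1"
    have "cmod (mform {1..d} n (\<lambda>j. of_real (e j)) x) \<le> 2 * sqrt (2 * \<Lambda>)"
    proof (rule mform_le_net_bound[OF d _ _ _ _ x, where Y = Y])
      show "cmod (of_real (e j)) = 1" if "j \<in> PiE {1..d} (\<lambda>k. {1..n k})" for j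
        using cube_memD[OF e] that by (force simp: J_def)
      show "Re (mform {1..d} n (\<lambda>j. of_real (e j)) y) \<le> sqrt (2 * \<Lambda>)" if "y \<in> PiE {1..d} Y" for y
        using le[OF that] by (simp add: mform_def J_def g_def)
    qed (use Y(3,4) in auto)
    also note bound
    finally show "cmod (mform {1..d} n (\<lambda>j. of_real (e j)) x)
      \<le> 8 * sqrt (ln (1 + 4 * real d)) * (\<Sum>k=1..d. sqrt (n k))" unfolding L_def .
  qed
qed

text \<open>
  Hoelder's inequality, obtained by summing Young's inequality for the numbers \<open>n * |x\<^sub>i| powr r\<close> and \<open>1\<close>
  with weights \<open>2 / r\<close> and \<open>1 - 2 / r\<close>; the case \<open>p = \<infinity>\<close> is immediate.
\<close>

lemma l2_le_lp_norm:
  assumes p: "2 \<le> p" and n: "1 \<le> n" and x: "lp_norm p n x \<le> 1"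
  shows "l2 n x \<le> real n powr (1/2 - recip p)"
  using p
proof (cases rule: two_le_ereal_cases)
  case 1
  have "l2 n x \<le> L2_set (\<lambda>_. 1) {1..n}"
    unfolding l2_def by (rule L2_set_mono) (use norm_le_lp_norm[OF p x] in auto)
  then show ?thesis using 1 n by (simp add: L2_set_constant powr_half_sqrt)
next
  case (2 r)
  have young: "real n powr (2 / r) * (norm (x i))\<^sup>2 \<le> 2 / r * (n * norm (x i) powr r) + (1 - 2 / r)" for i
  proof (cases "x i = 0")
    case True
    then show ?thesis using 2(2) by simp
  next
    case False
    have "(n * norm (x i) powr r) powr (2 / r) * 1 powr (1 - 2 / r)
        \<le> 2 / r * (n * norm (x i) powr r) + (1 - 2 / r) * 1"
      by (rule Youngs_inequality_0) (use 2(2) n False in auto)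
    moreover have "(n * norm (x i) powr r) powr (2 / r) = real n powr (2 / r) * (norm (x i))\<^sup>2"
      using 2(2) False by (simp add: powr_mult powr_powr powr_numeral)
    ultimately show ?thesis by simp
  qed
  have "real n powr (2 / r) * (\<Sum>i=1..n. (norm (x i))\<^sup>2)
      \<le> (\<Sum>i=1..n. 2 / r * (n * norm (x i) powr r) + (1 - 2 / r))"
    unfolding sum_distrib_left by (intro sum_mono young)
  also have "\<dots> = 2 / r * n * (\<Sum>i=1..n. norm (x i) powr r) + n * (1 - 2 / r)"
    by (simp add: sum.distrib sum_distrib_left mult_ac)
  also have "\<dots> \<le> 2 / r * n * 1 + n * (1 - 2 / r)"
    using sum_powr_le_one[of r n x] 2 x by (intro add_right_mono mult_left_mono) auto
  also have "\<dots> = real n" by (simp add: algebra_simps)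
  finally have "(\<Sum>i=1..n. (norm (x i))\<^sup>2) \<le> real n / real n powr (2 / r)"
    using n by (simp add: field_simps)
  also have "\<dots> = real n powr (1 - 2 / r)"
    using n by (simp add: powr_diff)
  also have "\<dots> = (real n powr (1/2 - recip p))\<^sup>2"
  proof -
    have "1 - 2 / r = (1/2 - recip p) + (1/2 - recip p)" unfolding 2(3) by simp
    then show ?thesis by (simp only: powr_add power2_eq_square)
  qed
  finally show ?thesis
    unfolding l2_def L2_set_def by (intro real_le_lsqrt) auto
qed

lemma form_norm_le:
  fixes a :: "(nat \<Rightarrow> nat) \<Rightarrow> 'k::real_normed_field"
  assumes p: "\<And>k. k \<in> {1..d} \<Longrightarrow> 2 \<le> p k" and n: "\<And>k. k \<in> {1..d} \<Longrightarrow> 1 \<le> n k"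
    and B: "\<And>x. (\<And>k. k \<in> {1..d} \<Longrightarrow> l2 (n k) (x k) \<le> 1) \<Longrightarrow> norm (mform {1..d} n a x) \<le> B"
  shows "form_norm d n p (mform {1..d} n a) \<le> B * (\<Prod>k=1..d. n k powr (1/2 - recip (p k)))"
  unfolding form_norm_def
proof (rule cSUP_least)
  have "lp_norm (p k) (n k) (\<lambda>_. 0 :: 'k) \<le> 1" if "k \<in> {1..d}" for k
    using n[OF that] by (auto simp: lp_norm_def)
  then have "(\<lambda>(_::nat) (_::nat). 0 :: 'k) \<in> {x. \<forall>k\<in>{1..d}. lp_norm (p k) (n k) (x k) \<le> 1}" by simp
  then show "{x :: nat \<Rightarrow> nat \<Rightarrow> 'k. \<forall>k\<in>{1..d}. lp_norm (p k) (n k) (x k) \<le> 1} \<noteq> {}"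
    by (rule ex_in_conv[THEN iffD1, OF exI])
next
  fix x :: "nat \<Rightarrow> nat \<Rightarrow> 'k"
  assume "x \<in> {x. \<forall>k\<in>{1..d}. lp_norm (p k) (n k) (x k) \<le> 1}"
  then have x: "lp_norm (p k) (n k) (x k) \<le> 1" if "k \<in> {1..d}" for k using that by blast
  define c where "c = (\<lambda>k. real (n k) powr (1/2 - recip (p k)))"
  have c: "0 < c k" if "k \<in> {1..d}" for k using n[OF that] by (simp add: c_def)
  let ?y = "\<lambda>k i. of_real (inverse (c k)) * x k i"
  have "mform {1..d} n a x = mform {1..d} n a (\<lambda>k i. of_real (c k) * ?y k i)"
    by (rule mform_cong) (simp add: c less_imp_neq[OF c, symmetric])
  also have "\<dots> = of_real (\<Prod>k=1..d. c k) * mform {1..d} n a ?y"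
    unfolding of_real_prod by (rule mform_scale)
  finally have "norm (mform {1..d} n a x) = \<bar>\<Prod>k=1..d. c k\<bar> * norm (mform {1..d} n a ?y)"
    by (simp only: norm_mult norm_of_real)
  also have "\<dots> = (\<Prod>k=1..d. c k) * norm (mform {1..d} n a ?y)"
    by (simp add: c_def abs_prod)
  also have "\<dots> \<le> (\<Prod>k=1..d. c k) * B"
  proof (intro mult_left_mono B prod_nonneg)
    fix k assume k: "k \<in> {1..d}"
    have "l2 (n k) (x k) \<le> c k"
      unfolding c_def by (rule l2_le_lp_norm[OF p[OF k] n[OF k] x[OF k]])
    then show "l2 (n k) (?y k) \<le> 1"
      unfolding l2_scale norm_of_real using c[OF k] by (simp add: field_simps)
  qed (simp add: c_def)
  finally show "norm (mform {1..d} n a x) \<le> B * (\<Prod>k=1..d. n k powr (1/2 - recip (p k)))"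
    by (simp add: c_def mult.commute)
qed

lemma upper_const_ge:
  assumes d: "1 \<le> d" and p: "\<And>k. k \<in> {1..d} \<Longrightarrow> 2 \<le> p k"
  shows "8 * sqrt (ln (1 + 4 * real d)) \<le> upper_const d p"
proof -
  have "Max (p ` {1..d}) \<in> p ` {1..d}" using d by (intro Max_in) auto
  then have "2 \<le> Max (p ` {1..d})" using p by auto
  then have "recip (Max (p ` {1..d})) \<le> 1"
    by (cases rule: two_le_ereal_cases) auto
  then have "1 \<le> fact d powr (1 - max (1/2) (recip (Max (p ` {1..d}))))"
    by (intro ge_one_powr_ge_zero) auto
  then have "8 * 1 * sqrt (ln (1 + 4 * real d)) \<le> upper_const d p"
    unfolding upper_const_def by (intro mult_right_mono mult_left_mono) (use d in auto)
  then show ?thesis by simp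
qed

lemma mform_signs_unimodular:
  assumes "\<And>j. j \<in> PiE {1..d} (\<lambda>k. {1..n k}) \<Longrightarrow> e j = 1 \<or> e j = (-1::real)"
  shows "mform {1..d} n (\<lambda>j. of_real (e j) :: 'k::real_normed_field) \<in> unimodular_forms d n"
  unfolding unimodular_forms_def mform_def multi_indices_def
proof (intro CollectI exI[of _ "\<lambda>j. of_real (e j)"] conjI ballI refl)
  show "of_real (e j) \<in> {-1, 1 :: 'k}" if "j \<in> PiE {1..d} (\<lambda>k. {1..n k})" for j
    using assms[OF that] by auto
qed

text \<open>
  Signs \<open>e\<close> whose form is small on Euclidean balls over the scalars \<open>'k\<close> witness the upper bound of the
  infimum over \<open>'k\<close>, as \<open>form_norm_le\<close> produces exactly the product in the denominator.
\<close>

lemma inf_normalized_norm_le: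
  fixes e :: "(nat \<Rightarrow> nat) \<Rightarrow> real"
  assumes d: "1 \<le> d"
    and p: "\<And>k. k \<in> {1..d} \<Longrightarrow> 2 \<le> p k" and n: "\<And>k. k \<in> {1..d} \<Longrightarrow> 1 \<le> n k"
    and e: "\<And>j. j \<in> PiE {1..d} (\<lambda>k. {1..n k}) \<Longrightarrow> e j = 1 \<or> e j = -1"
    and B: "\<And>x :: nat \<Rightarrow> nat \<Rightarrow> 'k. (\<And>k. k \<in> {1..d} \<Longrightarrow> l2 (n k) (x k) \<le> 1) \<Longrightarrow>
      norm (mform {1..d} n (\<lambda>j. of_real (e j)) x)
        \<le> 8 * sqrt (ln (1 + 4 * real d)) * (\<Sum>k=1..d. sqrt (n k))"
  shows "inf_normalized_norm TYPE('k::real_normed_field) d n p \<le> upper_const d p"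
proof -
  let ?A = "mform {1..d} n (\<lambda>j. of_real (e j)) :: (nat \<Rightarrow> nat \<Rightarrow> 'k) \<Rightarrow> 'k"
  define P where "P = (\<Prod>k=1..d. real (n k) powr (1/2 - recip (p k)))"
  define S where "S = (\<Sum>k=1..d. real (n k) powr (1/2))"
  have A: "?A \<in> unimodular_forms d n" using e by (rule mform_signs_unimodular)
  have "bdd_below (normalized_norm d n p ` (unimodular_forms d n :: ((nat \<Rightarrow> nat \<Rightarrow> 'k) \<Rightarrow> 'k) set))"
    by (rule bdd_belowI2) (rule normalized_norm_ge[OF d _ p n])
  then have "inf_normalized_norm TYPE('k) d n p \<le> normalized_norm d n p ?A"
    unfolding inf_normalized_norm_def by (rule cINF_lower[OF _ A])
  also have "\<dots> \<le> 8 * sqrt (ln (1 + 4 * real d)) * S * P / (S * P)"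
    unfolding normalized_norm_def S_def[symmetric] P_def[symmetric]
  proof (rule divide_right_mono)
    have "S = (\<Sum>k=1..d. sqrt (n k))" by (simp add: S_def powr_half_sqrt)
    then show "form_norm d n p ?A \<le> 8 * sqrt (ln (1 + 4 * real d)) * S * P"
      unfolding P_def using form_norm_le[where p = p and n = n, OF p n B] by simp
    show "0 \<le> S * P"
      unfolding S_def P_def by (intro mult_nonneg_nonneg sum_nonneg prod_nonneg) auto
  qed
  also have "\<dots> \<le> 8 * sqrt (ln (1 + 4 * real d))"
    by (cases "S * P = 0") (use d in auto)
  also have "\<dots> \<le> upper_const d p" by (rule upper_const_ge[OF d p])
  finally show ?thesis .
qed

lemma inf_normalized_norm_ge:
  assumes "1 \<le> d"
    and "\<And>k. k \<in> {1..d} \<Longrightarrow> 2 \<le> p k" and "\<And>k. k \<in> {1..d} \<Longrightarrow> 1 \<le> n k"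
  shows "1 / (real d * 2 powr ((real d - 1) / 2)) \<le> inf_normalized_norm TYPE('k::real_normed_field) d n p"
  unfolding inf_normalized_norm_def
proof (rule cINF_greatest)
  have "mform {1..d} n (\<lambda>j. of_real 1 :: 'k) \<in> unimodular_forms d n"
    by (rule mform_signs_unimodular) simp
  then show "(unimodular_forms d n :: ((nat \<Rightarrow> nat \<Rightarrow> 'k) \<Rightarrow> 'k) set) \<noteq> {}"
    by (rule ex_in_conv[THEN iffD1, OF exI])
next
  fix A :: "(nat \<Rightarrow> nat \<Rightarrow> 'k) \<Rightarrow> 'k" assume "A \<in> unimodular_forms d n"
  with assms(1) show "1 / (real d * 2 powr ((real d - 1) / 2)) \<le> normalized_norm d n p A"
    using assms(2,3) by (rule normalized_norm_ge)
qed

theorem theorem3p1: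
  fixes d :: nat and p :: "nat \<Rightarrow> ereal" and n :: "nat \<Rightarrow> nat"
  assumes "d \<ge> 1"
    and "\<And>k. k \<in> {1..d} \<Longrightarrow> 2 \<le> p k"
    and "\<And>k. k \<in> {1..d} \<Longrightarrow> n k \<ge> 1"
  shows "1 / (real d * 2 powr ((real d - 1) / 2)) \<le> inf_normalized_norm TYPE(real) d n p \<and>
         inf_normalized_norm TYPE(real) d n p \<le> upper_const d p \<and>
         1 / (real d * 2 powr ((real d - 1) / 2)) \<le> inf_normalized_norm TYPE(complex) d n p \<and>
         inf_normalized_norm TYPE(complex) d n p \<le> upper_const d p"
  using assms(1)
proof (rule exists_signs_small[where n = n])
  show "1 \<le> n k" if "k \<in> {1..d}" for k using assms(3) that .
  fix e :: "(nat \<Rightarrow> nat) \<Rightarrow> real"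
  assume e: "\<And>j. j \<in> PiE {1..d} (\<lambda>k. {1..n k}) \<Longrightarrow> e j = 1 \<or> e j = -1"
    and complex: "\<And>x. (\<And>k. k \<in> {1..d} \<Longrightarrow> l2 (n k) (x k) \<le> 1) \<Longrightarrow>
      cmod (mform {1..d} n (\<lambda>j. of_real (e j)) x) \<le> 8 * sqrt (ln (1 + 4 * real d)) * (\<Sum>k=1..d. sqrt (n k))"
  \<comment> \<open>Real Euclidean balls lie in the complex ones, and the form takes the same values there.\<close>
  have real: "norm (mform {1..d} n (\<lambda>j. of_real (e j)) x)
      \<le> 8 * sqrt (ln (1 + 4 * real d)) * (\<Sum>k=1..d. sqrt (n k))"
    if x: "\<And>k. k \<in> {1..d} \<Longrightarrow> l2 (n k) (x k) \<le> 1" for x :: "nat \<Rightarrow> nat \<Rightarrow> real"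
  proof -
    have "l2 (n k) (\<lambda>i. of_real (x k i) :: complex) \<le> 1" if "k \<in> {1..d}" for k
      using x[OF that] by (simp add: l2_def)
    then have "cmod (mform {1..d} n (\<lambda>j. of_real (e j)) (\<lambda>k i. of_real (x k i)))
        \<le> 8 * sqrt (ln (1 + 4 * real d)) * (\<Sum>k=1..d. sqrt (n k))"
      by (rule complex)
    then show ?thesis by (simp only: mform_of_real norm_of_real of_real_eq_id id_apply real_norm_def)
  qed
  note lower = inf_normalized_norm_ge[where d = d and n = n and p = p]
  show ?thesis
  proof (intro conjI)
    show "1 / (real d * 2 powr ((real d - 1) / 2)) \<le> inf_normalized_norm TYPE(real) d n p"
      using assms by (rule lower)
    show "1 / (real d * 2 powr ((real d - 1) / 2)) \<le> inf_normalized_norm TYPE(complex) d n p"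
      using assms by (rule lower)
    show "inf_normalized_norm TYPE(real) d n p \<le> upper_const d p"
      using assms e real by (rule inf_normalized_norm_le[where n = n and p = p and e = e])
    show "inf_normalized_norm TYPE(complex) d n p \<le> upper_const d p"
      using assms e complex by (rule inf_normalized_norm_le[where n = n and p = p and e = e])
  qed
qed

end
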